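(* For every $n\in\mathbb{N}$ and every $p>1$, $$\operatorname{asdim}\,\mathcal{D}_{\mathcal{W},p}^{n}=\operatorname{asdim}\,\mathcal{D}_{\mathcal{B}}^{n}=2n,$$ and hence each of the metric spaces $\mathcal{D}_{\mathcal{W},p}^{n}$ and $\mathcal{D}_{\mathcal{B}}^{n}$ coarsely embeds into Hilbert space.
   Context: $\mathbb{N}=\{1,2,\dots\}$. Spaces of persistence diagrams. Let $d_\infty((x_1,x_2),(y_1,y_2))=\max\{|x_1-y_1|,|x_2-y_2|\}$ on $\mathbb{R}^2$, let $T=\{(x_1,x_2)\in\mathbb{R}^2 \mid x_2>x_1\ge 0\}$, let $\Delta\notin T$ be an extra point (representing the diagonal), and put $\mathcal{D}^1=T\cup\{\Delta\}$. Define the semi-metric $\delta$ on $\mathcal{D}^1$ by $\delta=d_\infty$ on $T$, $\delta((x_1,x_2),\Delta)=\delta(\Delta,(x_1,x_2))=(x_2-x_1)/2$, $\delta(\Delta,\Delta)=0$. For $n\in\mathbb{N}$, the space of persistence diagrams on at most $n$ points is the set $\mathcal{D}^n=(\mathcal{D}^1)^n/\mathcal{S}_n$, where the symmetric group $\mathcal{S}_n$ permutes coordinates. For $z=(z_1,\dots,z_n)$, $z'=(z_1',\dots,z_n')$ in $\mathcal{D}^n$, put $z_i=z_i'=\Delta$ for $n<i\le 2n$ and define $$d_{\mathcal{B}}(z,z')=\min_{\varphi\in\mathcal{S}_{2n}}\max_{1\le i\le 2n}\delta(z_i,z'_{\varphi(i)}),\qquad d_{\mathcal{W},p}(z,z')=\min_{\varphi\in\mathcal{S}_{2n}}\Big(\sum_{i=1}^{2n}\delta(z_i,z'_{\varphi(i)})^p\Big)^{1/p}$$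 (the bottleneck and the $p$-Wasserstein distance). Set $\mathcal{D}_{\mathcal{B}}^n=(\mathcal{D}^n,d_{\mathcal{B}})$ and $\mathcal{D}_{\mathcal{W},p}^n=(\mathcal{D}^n,d_{\mathcal{W},p})$. Asymptotic dimension. For a non-negative integer $m$, $\operatorname{asdim}X\le m$ for a metric space $X$ iff for every $R>0$, $X$ is the union of $m+1$ subsets $X_0,\dots,X_m$, each $X_i$ being the union of a family of uniformly bounded, $R$-disjoint sets (uniformly bounded: the diameters of the members have a common finite upper bound; $R$-disjoint: distinct members are at distance at least $R$). $\operatorname{asdim}X$ is the least such $m$. Coarse embedding. A function $f:X\to Y$ between metric spaces is a coarse embedding if there are non-decreasing functions $\rho_1,\rho_2:[0,\infty)\to[0,\infty)$ with $\lim_{t\to\infty}\rho_1(t)=\infty$ and $\rho_1(d(x_1,x_2))\le d(f(x_1),f(x_2))\le\rho_2(d(x_1,x_2))$ for all $x_1,x_2\in X$. $X$ coarsely embeds into Hilbert space if there is a coarse embedding of $X$ into a Hilbert space. *)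

theory Defs
  imports "HOL-Analysis.Analysis"
begin

section \<open>Spaces of persistence diagrams\<close>

text \<open>A point of $\mathcal{D}^1$ is \<^term>\<open>Some (x1, x2)\<close> with \<^prop>\<open>x2 > x1 \<and> x1 \<ge> 0\<close>,
  or \<^term>\<open>None\<close>, which is the extra point $\Delta$.\<close>

type_synonym dgm_point = "(real \<times> real) option"

definition dinf :: "real \<times> real \<Rightarrow> real \<times> real \<Rightarrow> real" where
  "dinf x y = max \<bar>fst x - fst y\<bar> \<bar>snd x - snd y\<bar>"

definition T :: "(real \<times> real) set" where
  "T = {(x1, x2). x2 > x1 \<and> x1 \<ge> 0}"

definition D1 :: "dgm_point set" where
  "D1 = insert None (Some ` T)"

fun delta :: "dgm_point \<Rightarrow> dgm_point \<Rightarrow> real" where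
  "delta (Some x) (Some y) = dinf x y"
| "delta (Some x) None = (snd x - fst x) / 2"
| "delta None (Some y) = (snd y - fst y) / 2"
| "delta None None = 0"

definition tuples :: "nat \<Rightarrow> (nat \<Rightarrow> dgm_point) set" where
  "tuples n = {1..n} \<rightarrow>\<^sub>E D1"

definition perm_rel :: "nat \<Rightarrow> ((nat \<Rightarrow> dgm_point) \<times> (nat \<Rightarrow> dgm_point)) set" where
  "perm_rel n = {(z, z'). z \<in> tuples n \<and> z' \<in> tuples n \<and>
                          (\<exists>\<sigma>. \<sigma> permutes {1..n} \<and> z' = z \<circ> \<sigma>)}"

definition diagrams :: "nat \<Rightarrow> (nat \<Rightarrow> dgm_point) set set" where
  "diagrams n = tuples n // perm_rel n"

definition pad :: "nat \<Rightarrow> (nat \<Rightarrow> dgm_point) \<Rightarrow> nat \<Rightarrow> dgm_point" where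
  "pad n z i = (if i \<le> n then z i else None)"

definition tuple_bottleneck :: "nat \<Rightarrow> (nat \<Rightarrow> dgm_point) \<Rightarrow> (nat \<Rightarrow> dgm_point) \<Rightarrow> real" where
  "tuple_bottleneck n z z' =
     (MIN \<phi>\<in>{\<phi>. \<phi> permutes {1..2*n}}. MAX i\<in>{1..2*n}. delta (pad n z i) (pad n z' (\<phi> i)))"

definition tuple_wasserstein ::
    "nat \<Rightarrow> real \<Rightarrow> (nat \<Rightarrow> dgm_point) \<Rightarrow> (nat \<Rightarrow> dgm_point) \<Rightarrow> real" where
  "tuple_wasserstein n p z z' =
     (MIN \<phi>\<in>{\<phi>. \<phi> permutes {1..2*n}}.
        (\<Sum>i=1..2*n. delta (pad n z i) (pad n z' (\<phi> i)) powr p) powr (1 / p))"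

text \<open>The distances of two classes are computed on representatives; the lemmas
  \<open>bottleneck_dist_eq\<close> and \<open>wasserstein_dist_eq\<close> below show that the choice does not matter.\<close>

definition bottleneck_dist ::
    "nat \<Rightarrow> (nat \<Rightarrow> dgm_point) set \<Rightarrow> (nat \<Rightarrow> dgm_point) set \<Rightarrow> real" where
  "bottleneck_dist n Z Z' = tuple_bottleneck n (SOME z. z \<in> Z) (SOME z'. z' \<in> Z')"

definition wasserstein_dist ::
    "nat \<Rightarrow> real \<Rightarrow> (nat \<Rightarrow> dgm_point) set \<Rightarrow> (nat \<Rightarrow> dgm_point) set \<Rightarrow> real" where
  "wasserstein_dist n p Z Z' = tuple_wasserstein n p (SOME z. z \<in> Z) (SOME z'. z' \<in> Z')"

lemma tuples_comp_perm:
  assumes "z \<in> tuples n" "\<sigma> permutes {1..n}"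
  shows "z \<circ> \<sigma> \<in> tuples n"
proof -
  have "(z \<circ> \<sigma>) i \<in> D1" if "i \<in> {1..n}" for i
  proof -
    have "\<sigma> i \<in> {1..n}" using permutes_in_image[OF assms(2)] that by blast
    then show ?thesis using PiE_mem[OF assms(1)[unfolded tuples_def]] by simp
  qed
  moreover have "(z \<circ> \<sigma>) i = undefined" if "i \<notin> {1..n}" for i
    using PiE_arb[OF assms(1)[unfolded tuples_def] that] permutes_not_in[OF assms(2) that] by simp
  ultimately show ?thesis
    unfolding tuples_def by (intro PiE_I) auto
qed

lemma equiv_perm_rel: "equiv (tuples n) (perm_rel n)"
proof (rule equivI)
  show "perm_rel n \<subseteq> tuples n \<times> tuples n"
    by (auto simp: perm_rel_def)
  show "refl_on (tuples n) (perm_rel n)"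
  proof (rule refl_onI)
    fix z assume "z \<in> tuples n"
    moreover have "z = z \<circ> id" by simp
    ultimately show "(z, z) \<in> perm_rel n"
      using permutes_id[of "{1..n}"] unfolding perm_rel_def by blast
  qed
  show "sym (perm_rel n)"
  proof (rule symI)
    fix z z' assume "(z, z') \<in> perm_rel n"
    then obtain \<sigma> where s: "\<sigma> permutes {1..n}" "z' = z \<circ> \<sigma>" "z \<in> tuples n" "z' \<in> tuples n"
      by (auto simp: perm_rel_def)
    have "z = z' \<circ> inv \<sigma>"
      using permutes_inv_o(1)[OF s(1)] by (simp add: s(2) o_assoc[symmetric])
    then show "(z', z) \<in> perm_rel n"
      using s permutes_inv[OF s(1)] by (auto simp: perm_rel_def)
  qed
  show "trans (perm_rel n)"
  proof (rule transI)
    fix x y z assume "(x, y) \<in> perm_rel n" "(y, z) \<in> perm_rel n"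
    then obtain \<sigma> \<tau> where s: "\<sigma> permutes {1..n}" "y = x \<circ> \<sigma>" "\<tau> permutes {1..n}" "z = y \<circ> \<tau>"
        "x \<in> tuples n" "z \<in> tuples n"
      by (auto simp: perm_rel_def)
    have "z = x \<circ> (\<sigma> \<circ> \<tau>)" by (simp add: s o_assoc)
    then show "(x, z) \<in> perm_rel n"
      using s permutes_compose[OF s(3,1)] unfolding perm_rel_def by blast
  qed
qed

lemma pad_comp_perm:
  assumes "\<sigma> permutes {1..n}"
  shows "pad n (z \<circ> \<sigma>) = pad n z \<circ> \<sigma>"
proof
  fix i
  show "pad n (z \<circ> \<sigma>) i = (pad n z \<circ> \<sigma>) i"
  proof (cases "i \<in> {1..n}")
    case True
    then have "\<sigma> i \<in> {1..n}" using permutes_in_image[OF assms] by blast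
    then show ?thesis using True by (simp add: pad_def)
  next
    case False
    then have "\<sigma> i = i" using permutes_not_in[OF assms] by blast
    then show ?thesis by (simp add: pad_def)
  qed
qed

lemma perm_costs_invariant:
  fixes c :: "(nat \<Rightarrow> real) \<Rightarrow> real"
  assumes c: "\<And>w \<pi>. \<pi> permutes {1..2*n} \<Longrightarrow> c (w \<circ> \<pi>) = c w"
    and s: "\<sigma> permutes {1..n}" and t: "\<tau> permutes {1..n}"
  shows "(\<lambda>\<phi>. c (\<lambda>i. delta (pad n (z \<circ> \<sigma>) i) (pad n (z' \<circ> \<tau>) (\<phi> i)))) ` {\<phi>. \<phi> permutes {1..2*n}}
       = (\<lambda>\<phi>. c (\<lambda>i. delta (pad n z i) (pad n z' (\<phi> i)))) ` {\<phi>. \<phi> permutes {1..2*n}}"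
    (is "?f ` ?P = ?g ` ?P")
proof -
  have sub: "{1..n} \<subseteq> {1..2*n}" by auto
  note s' = permutes_subset[OF s sub] and t' = permutes_subset[OF t sub]
  define h where "h \<phi> = \<tau> \<circ> \<phi> \<circ> inv \<sigma>" for \<phi> :: "nat \<Rightarrow> nat"
  have eq: "?f \<phi> = ?g (h \<phi>)" for \<phi>
  proof -
    have "(\<lambda>i. delta (pad n (z \<circ> \<sigma>) i) (pad n (z' \<circ> \<tau>) (\<phi> i)))
        = (\<lambda>i. delta (pad n z i) (pad n z' (h \<phi> i))) \<circ> \<sigma>"
      by (auto simp: pad_comp_perm[OF s] pad_comp_perm[OF t] h_def permutes_inverses(2)[OF s])
    then show ?thesis using c[OF s'] by simp
  qed
  have "h ` ?P = ?P"
  proof (intro equalityI subsetI)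
    fix \<psi> assume "\<psi> \<in> h ` ?P"
    then show "\<psi> \<in> ?P"
      using permutes_compose[OF permutes_compose[OF permutes_inv[OF s']] t']
      by (auto simp: h_def o_assoc)
  next
    fix \<psi> assume p: "\<psi> \<in> ?P"
    have "h (inv \<tau> \<circ> \<psi> \<circ> \<sigma>) = \<psi>"
      by (auto simp: h_def fun_eq_iff permutes_inverses[OF s] permutes_inverses[OF t])
    moreover have "inv \<tau> \<circ> \<psi> \<circ> \<sigma> \<in> ?P"
      using p permutes_compose[OF s' permutes_compose[OF _ permutes_inv[OF t']]] by auto
    ultimately show "\<psi> \<in> h ` ?P" by (metis imageI)
  qed
  then have "?g ` ?P = (\<lambda>\<phi>. ?g (h \<phi>)) ` ?P" by (metis image_image)
  then show ?thesis by (simp only: eq)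
qed

lemma tuple_bottleneck_invariant:
  assumes "\<sigma> permutes {1..n}" "\<tau> permutes {1..n}"
  shows "tuple_bottleneck n (z \<circ> \<sigma>) (z' \<circ> \<tau>) = tuple_bottleneck n z z'"
proof -
  have "(MAX i\<in>{1..2*n}. (w \<circ> \<pi>) i) = (MAX i\<in>{1..2*n}. w i)"
    if "\<pi> permutes {1..2*n}" for w :: "nat \<Rightarrow> real" and \<pi>
    by (metis image_comp permutes_image[OF that])
  from perm_costs_invariant[where c = "\<lambda>w. MAX i\<in>{1..2*n}. w i", OF this assms]
  show ?thesis unfolding tuple_bottleneck_def by simp
qed

lemma tuple_wasserstein_invariant:
  assumes "\<sigma> permutes {1..n}" "\<tau> permutes {1..n}"
  shows "tuple_wasserstein n p (z \<circ> \<sigma>) (z' \<circ> \<tau>) = tuple_wasserstein n p z z'"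
proof -
  have "(\<Sum>i=1..2*n. (w \<circ> \<pi>) i powr p) powr (1/p) = (\<Sum>i=1..2*n. w i powr p) powr (1/p)"
    if "\<pi> permutes {1..2*n}" for w :: "nat \<Rightarrow> real" and \<pi>
    using sum.permute[OF that, of "\<lambda>i. w i powr p"] by (simp add: o_def)
  from perm_costs_invariant[where c = "\<lambda>w. (\<Sum>i=1..2*n. w i powr p) powr (1/p)", OF this assms]
  show ?thesis unfolding tuple_wasserstein_def by simp
qed

lemma some_representative:
  assumes "Z \<in> diagrams n" "z \<in> Z"
  obtains \<sigma> where "\<sigma> permutes {1..n}" "(SOME z. z \<in> Z) = z \<circ> \<sigma>"
proof -
  have "(SOME z. z \<in> Z) \<in> Z" using someI[of "\<lambda>z. z \<in> Z", OF assms(2)] .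
  then have "(z, SOME z. z \<in> Z) \<in> perm_rel n"
    using quotient_eq_iff[OF equiv_perm_rel, of Z n Z z "SOME z. z \<in> Z"] assms
    unfolding diagrams_def by blast
  then show thesis using that by (auto simp: perm_rel_def)
qed

lemma bottleneck_dist_eq:
  assumes "Z \<in> diagrams n" "Z' \<in> diagrams n" "z \<in> Z" "z' \<in> Z'"
  shows "bottleneck_dist n Z Z' = tuple_bottleneck n z z'"
proof -
  obtain \<sigma> where s: "\<sigma> permutes {1..n}" "(SOME z. z \<in> Z) = z \<circ> \<sigma>"
    using some_representative[OF assms(1,3)] .
  obtain \<tau> where t: "\<tau> permutes {1..n}" "(SOME z'. z' \<in> Z') = z' \<circ> \<tau>"
    using some_representative[OF assms(2,4)] .
  show ?thesis
    unfolding bottleneck_dist_def s(2) t(2) by (rule tuple_bottleneck_invariant[OF s(1) t(1)])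
qed

lemma wasserstein_dist_eq:
  assumes "Z \<in> diagrams n" "Z' \<in> diagrams n" "z \<in> Z" "z' \<in> Z'"
  shows "wasserstein_dist n p Z Z' = tuple_wasserstein n p z z'"
proof -
  obtain \<sigma> where s: "\<sigma> permutes {1..n}" "(SOME z. z \<in> Z) = z \<circ> \<sigma>"
    using some_representative[OF assms(1,3)] .
  obtain \<tau> where t: "\<tau> permutes {1..n}" "(SOME z'. z' \<in> Z') = z' \<circ> \<tau>"
    using some_representative[OF assms(2,4)] .
  show ?thesis
    unfolding wasserstein_dist_def s(2) t(2) by (rule tuple_wasserstein_invariant[OF s(1) t(1)])
qed


section \<open>Asymptotic dimension\<close>

definition uniformly_bounded :: "('a \<Rightarrow> 'a \<Rightarrow> real) \<Rightarrow> 'a set set \<Rightarrow> bool" where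
  "uniformly_bounded d \<U> \<longleftrightarrow> (\<exists>B. \<forall>U\<in>\<U>. \<forall>x\<in>U. \<forall>y\<in>U. d x y \<le> B)"

definition R_disjoint :: "('a \<Rightarrow> 'a \<Rightarrow> real) \<Rightarrow> real \<Rightarrow> 'a set set \<Rightarrow> bool" where
  "R_disjoint d R \<U> \<longleftrightarrow> (\<forall>U\<in>\<U>. \<forall>V\<in>\<U>. U \<noteq> V \<longrightarrow> (\<forall>x\<in>U. \<forall>y\<in>V. d x y \<ge> R))"

definition asdim_le :: "'a set \<Rightarrow> ('a \<Rightarrow> 'a \<Rightarrow> real) \<Rightarrow> nat \<Rightarrow> bool" where
  "asdim_le X d m \<longleftrightarrow>
     (\<forall>R>0. \<exists>Xs :: nat \<Rightarrow> 'a set.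
        X = (\<Union>i\<le>m. Xs i) \<and>
        (\<forall>i\<le>m. \<exists>\<U>. Xs i = \<Union>\<U> \<and> uniformly_bounded d \<U> \<and> R_disjoint d R \<U>))"

text \<open>The value is \<^term>\<open>\<infinity>\<close> if there is no bound.\<close>

definition asdim :: "'a set \<Rightarrow> ('a \<Rightarrow> 'a \<Rightarrow> real) \<Rightarrow> enat" where
  "asdim X d = Inf {enat m | m. asdim_le X d m}"


section \<open>The Hilbert spaces of square-summable families\<close>

typedef 'i ell2 = "{f :: 'i \<Rightarrow> real. (\<lambda>i. (f i)\<^sup>2) summable_on UNIV}"
  morphisms ell2_coord Abs_ell2
  by (rule exI[of _ "\<lambda>_. 0"]) simp

setup_lifting type_definition_ell2

lemma ell2_coord_summable: "(\<lambda>i. (ell2_coord f i)\<^sup>2) summable_on UNIV"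
  using ell2_coord[of f] by simp

lemma ell2_eqI: "(\<And>i. ell2_coord f i = ell2_coord g i) \<Longrightarrow> f = g"
  by (simp add: ell2_coord_inject[symmetric] fun_eq_iff)

lemma square_summable_add:
  fixes f g :: "'i \<Rightarrow> real"
  assumes "(\<lambda>i. (f i)\<^sup>2) summable_on UNIV" "(\<lambda>i. (g i)\<^sup>2) summable_on UNIV"
  shows "(\<lambda>i. (f i + g i)\<^sup>2) summable_on UNIV"
proof (rule summable_on_comparison_test)
  show "(\<lambda>i. 2 * (f i)\<^sup>2 + 2 * (g i)\<^sup>2) summable_on UNIV"
    using assms by (intro summable_on_add summable_on_cmult_right)
  show "(f i + g i)\<^sup>2 \<le> 2 * (f i)\<^sup>2 + 2 * (g i)\<^sup>2" for i
    using zero_le_power2[of "f i - g i"] by (simp add: power2_eq_square algebra_simps)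
qed auto

lemma square_summable_cmult:
  fixes f :: "'i \<Rightarrow> real"
  assumes "(\<lambda>i. (f i)\<^sup>2) summable_on UNIV"
  shows "(\<lambda>i. (c * f i)\<^sup>2) summable_on UNIV"
  using summable_on_cmult_right[OF assms, of "c\<^sup>2"] by (simp add: power_mult_distrib)

lemma square_summable_mult:
  fixes f g :: "'i \<Rightarrow> real"
  assumes "(\<lambda>i. (f i)\<^sup>2) summable_on UNIV" "(\<lambda>i. (g i)\<^sup>2) summable_on UNIV"
  shows "(\<lambda>i. f i * g i) summable_on UNIV"
proof -
  have "(\<lambda>i. (f i + g i)\<^sup>2 + (- 1) * (f i)\<^sup>2 + (- 1) * (g i)\<^sup>2) summable_on UNIV"
    using square_summable_add[OF assms] assms by (intro summable_on_add summable_on_cmult_right)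
  from summable_on_cmult_right[OF this, of "1/2"] show ?thesis
    by (rule summable_on_cong[THEN iffD1, rotated]) (simp add: power2_sum field_simps)
qed

instantiation ell2 :: (type) real_inner
begin

lift_definition zero_ell2 :: "'a ell2" is "\<lambda>_. 0" by simp

lift_definition plus_ell2 :: "'a ell2 \<Rightarrow> 'a ell2 \<Rightarrow> 'a ell2" is "\<lambda>f g i. f i + g i"
  by (rule square_summable_add)

lift_definition uminus_ell2 :: "'a ell2 \<Rightarrow> 'a ell2" is "\<lambda>f i. - f i" by simp

lift_definition minus_ell2 :: "'a ell2 \<Rightarrow> 'a ell2 \<Rightarrow> 'a ell2" is "\<lambda>f g i. f i - g i"
proof -
  fix f g :: "'a \<Rightarrow> real"
  assume "(\<lambda>i. (f i)\<^sup>2) summable_on UNIV" "(\<lambda>i. (g i)\<^sup>2) summable_on UNIV"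
  then show "(\<lambda>i. (f i - g i)\<^sup>2) summable_on UNIV"
    using square_summable_add[of f "\<lambda>i. - g i"] by simp
qed

lift_definition scaleR_ell2 :: "real \<Rightarrow> 'a ell2 \<Rightarrow> 'a ell2" is "\<lambda>c f i. c * f i"
  by (rule square_summable_cmult)

lift_definition inner_ell2 :: "'a ell2 \<Rightarrow> 'a ell2 \<Rightarrow> real"
  is "\<lambda>f g. \<Sum>\<^sub>\<infinity>i. f i * g i" .

definition norm_ell2 :: "'a ell2 \<Rightarrow> real" where
  "norm_ell2 f = sqrt (inner f f)"

definition sgn_ell2 :: "'a ell2 \<Rightarrow> 'a ell2" where
  "sgn_ell2 f = scaleR (inverse (norm f)) f"

definition dist_ell2 :: "'a ell2 \<Rightarrow> 'a ell2 \<Rightarrow> real" where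
  "dist_ell2 f g = norm (f - g)"

definition uniformity_ell2 :: "('a ell2 \<times> 'a ell2) filter" where
  "uniformity_ell2 = (INF e\<in>{0 <..}. principal {(f, g). dist f g < e})"

definition open_ell2 :: "'a ell2 set \<Rightarrow> bool" where
  "open_ell2 S = (\<forall>f\<in>S. \<forall>\<^sub>F (f', g) in uniformity. f' = f \<longrightarrow> g \<in> S)"

instance
proof
  fix f g h :: "'a ell2" and a b :: real
  show "f + g + h = f + (g + h)" by transfer (simp add: add.assoc)
  show "f + g = g + f" by transfer (simp add: add.commute)
  show "0 + f = f" by transfer simp
  show "- f + f = 0" by transfer simp
  show "f - g = f + - g" by transfer simp
  show "a *\<^sub>R (f + g) = a *\<^sub>R f + a *\<^sub>R g" by transfer (simp add: algebra_simps)
  show "(a + b) *\<^sub>R f = a *\<^sub>R f + b *\<^sub>R f" by transfer (simp add: algebra_simps)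
  show "a *\<^sub>R b *\<^sub>R f = (a * b) *\<^sub>R f" by transfer (simp add: algebra_simps)
  show "1 *\<^sub>R f = f" by transfer simp
  show "inner f g = inner g f" by transfer (simp add: mult.commute)
  show "inner (f + g) h = inner f h + inner g h"
    by transfer (simp add: distrib_right infsum_add square_summable_mult)
  show "inner (a *\<^sub>R f) g = a * inner f g"
    by transfer (simp add: mult.assoc infsum_cmult_right')
  show "0 \<le> inner f f" by transfer (simp add: infsum_nonneg)
  show "inner f f = 0 \<longleftrightarrow> f = 0"
  proof (transfer, safe)
    fix f :: "'a \<Rightarrow> real"
    assume s: "(\<lambda>i. (f i)\<^sup>2) summable_on UNIV" and z: "(\<Sum>\<^sub>\<infinity>i. f i * f i) = 0"
    show "f = (\<lambda>_. 0)"
    proof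
      fix i
      have "(\<Sum>j\<in>{i}. (f j)\<^sup>2) \<le> (\<Sum>\<^sub>\<infinity>j. (f j)\<^sup>2)"
        by (rule finite_sum_le_infsum[OF s]) auto
      then show "f i = 0" using z by (simp add: power2_eq_square[symmetric])
    qed
  qed simp
qed (rule norm_ell2_def sgn_ell2_def dist_ell2_def uniformity_ell2_def open_ell2_def)+

end

lemma sum_coord_le_norm_ell2:
  assumes "finite F"
  shows "(\<Sum>i\<in>F. (ell2_coord f i)\<^sup>2) \<le> (norm f)\<^sup>2"
proof -
  have "(norm f)\<^sup>2 = (\<Sum>\<^sub>\<infinity>i. (ell2_coord f i)\<^sup>2)"
    unfolding power2_norm_eq_inner by (simp add: inner_ell2.rep_eq power2_eq_square)
  then show ?thesis
    using finite_sum_le_infsum[OF ell2_coord_summable assms, of f] by simp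
qed

instance ell2 :: (type) complete_space
proof
  fix X :: "nat \<Rightarrow> 'a ell2"
  assume X: "Cauchy X"
  have "Cauchy (\<lambda>n. ell2_coord (X n) i)" for i
  proof (rule metric_CauchyI)
    fix e :: real assume "e > 0"
    then obtain M where M: "\<And>m n. m \<ge> M \<Longrightarrow> n \<ge> M \<Longrightarrow> dist (X m) (X n) < e"
      using metric_CauchyD[OF X] by blast
    have "dist (ell2_coord (X m) i) (ell2_coord (X n) i) \<le> dist (X m) (X n)" for m n
      using sum_coord_le_norm_ell2[of "{i}" "X m - X n"]
      by (simp add: dist_norm minus_ell2.rep_eq abs_le_square_iff[symmetric])
    then show "\<exists>M. \<forall>m\<ge>M. \<forall>n\<ge>M. dist (ell2_coord (X m) i) (ell2_coord (X n) i) < e"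
      using M by (meson le_less_trans)
  qed
  then have "\<forall>i. \<exists>l. (\<lambda>n. ell2_coord (X n) i) \<longlonglongrightarrow> l"
    by (simp add: Cauchy_convergent_iff convergent_def)
  then obtain g where g: "\<And>i. (\<lambda>n. ell2_coord (X n) i) \<longlonglongrightarrow> g i" by metis
  have tail: "\<exists>M. \<forall>m\<ge>M. \<forall>F. finite F \<longrightarrow> (\<Sum>i\<in>F. (ell2_coord (X m) i - g i)\<^sup>2) \<le> e\<^sup>2"
    if "e > 0" for e :: real
  proof -
    obtain M where M: "\<And>m n. m \<ge> M \<Longrightarrow> n \<ge> M \<Longrightarrow> dist (X m) (X n) < e"
      using metric_CauchyD[OF X \<open>e > 0\<close>] by blast
    have "(\<Sum>i\<in>F. (ell2_coord (X m) i - g i)\<^sup>2) \<le> e\<^sup>2" if "m \<ge> M" "finite F" for m F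
    proof (rule LIMSEQ_le_const2)
      show "(\<lambda>n. \<Sum>i\<in>F. (ell2_coord (X m) i - ell2_coord (X n) i)\<^sup>2)
              \<longlonglongrightarrow> (\<Sum>i\<in>F. (ell2_coord (X m) i - g i)\<^sup>2)"
        by (intro tendsto_intros g)
      have "(\<Sum>i\<in>F. (ell2_coord (X m) i - ell2_coord (X n) i)\<^sup>2) \<le> e\<^sup>2" if "n \<ge> M" for n
      proof -
        have "(\<Sum>i\<in>F. (ell2_coord (X m) i - ell2_coord (X n) i)\<^sup>2) \<le> (norm (X m - X n))\<^sup>2"
          using sum_coord_le_norm_ell2[OF \<open>finite F\<close>, of "X m - X n"]
          by (simp add: minus_ell2.rep_eq)
        also have "\<dots> \<le> e\<^sup>2"
          using M[OF \<open>m \<ge> M\<close> that] by (intro power_mono) (auto simp: dist_norm)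
        finally show ?thesis .
      qed
      then show "\<exists>N. \<forall>n\<ge>N. (\<Sum>i\<in>F. (ell2_coord (X m) i - ell2_coord (X n) i)\<^sup>2) \<le> e\<^sup>2"
        by blast
    qed
    then show ?thesis by blast
  qed
  have diff: "(\<lambda>i. (ell2_coord (X m) i - g i)\<^sup>2) summable_on UNIV"
    if "\<And>F. finite F \<Longrightarrow> (\<Sum>i\<in>F. (ell2_coord (X m) i - g i)\<^sup>2) \<le> e\<^sup>2" for m and e :: real
    by (rule nonneg_bdd_above_summable_on) (use that in \<open>auto intro!: bdd_aboveI[of _ "e\<^sup>2"]\<close>)
  obtain M1 where M1: "(\<lambda>i. (ell2_coord (X M1) i - g i)\<^sup>2) summable_on UNIV"
  proof -
    obtain M where "\<forall>m\<ge>M. \<forall>F. finite F \<longrightarrow> (\<Sum>i\<in>F. (ell2_coord (X m) i - g i)\<^sup>2) \<le> 1\<^sup>2"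
      using tail[of 1] by auto
    then have "(\<lambda>i. (ell2_coord (X M) i - g i)\<^sup>2) summable_on UNIV"
      by (intro diff[of M 1]) blast
    then show thesis by (rule that)
  qed
  have "(\<lambda>i. (ell2_coord (X M1) i + (- 1) * (ell2_coord (X M1) i - g i))\<^sup>2) summable_on UNIV"
    by (intro square_summable_add square_summable_cmult M1 ell2_coord_summable)
  then have "(\<lambda>i. (g i)\<^sup>2) summable_on UNIV" by simp
  then have G: "ell2_coord (Abs_ell2 g) = g" by (simp add: Abs_ell2_inverse)
  have "X \<longlonglongrightarrow> Abs_ell2 g"
  proof (rule metric_LIMSEQ_I)
    fix e :: real assume "e > 0"
    then obtain M where M: "\<And>m F. m \<ge> M \<Longrightarrow> finite F \<Longrightarrow>
        (\<Sum>i\<in>F. (ell2_coord (X m) i - g i)\<^sup>2) \<le> (e/2)\<^sup>2"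
      using tail[of "e/2"] by auto
    have "dist (X m) (Abs_ell2 g) < e" if "m \<ge> M" for m
    proof -
      have "(norm (X m - Abs_ell2 g))\<^sup>2 = (\<Sum>\<^sub>\<infinity>i. (ell2_coord (X m) i - g i)\<^sup>2)"
        unfolding power2_norm_eq_inner by (simp add: inner_ell2.rep_eq minus_ell2.rep_eq G power2_eq_square)
      also have "\<dots> \<le> (e/2)\<^sup>2"
        by (rule infsum_le_finite_sums[OF diff[OF M[OF that]] M[OF that]])
      finally have "norm (X m - Abs_ell2 g) \<le> e/2"
        using \<open>e > 0\<close> by (simp add: power2_le_iff_abs_le)
      then show ?thesis using \<open>e > 0\<close> by (simp add: dist_norm)
    qed
    then show "\<exists>M. \<forall>m\<ge>M. dist (X m) (Abs_ell2 g) < e" by blast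
  qed
  then show "convergent X" by (auto simp: convergent_def)
qed


section \<open>Coarse embeddings\<close>

definition coarse_embedding ::
    "'a set \<Rightarrow> ('a \<Rightarrow> 'a \<Rightarrow> real) \<Rightarrow> 'b set \<Rightarrow> ('b \<Rightarrow> 'b \<Rightarrow> real) \<Rightarrow> ('a \<Rightarrow> 'b) \<Rightarrow> bool" where
  "coarse_embedding X dX Y dY f \<longleftrightarrow>
     f \<in> X \<rightarrow> Y \<and>
     (\<exists>\<rho>1 \<rho>2 :: real \<Rightarrow> real.
        \<rho>1 \<in> {0..} \<rightarrow> {0..} \<and> \<rho>2 \<in> {0..} \<rightarrow> {0..} \<and>
        mono_on {0..} \<rho>1 \<and> mono_on {0..} \<rho>2 \<and>
        filterlim \<rho>1 at_top at_top \<and>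
        (\<forall>x\<in>X. \<forall>y\<in>X. \<rho>1 (dX x y) \<le> dY (f x) (f y) \<and> dY (f x) (f y) \<le> \<rho>2 (dX x y)))"

text \<open>A definition cannot quantify existentially over types of class
  \<^class>\<open>real_inner\<close> and \<^class>\<open>complete_space\<close>, so the target is the space of square-summable
  families indexed by \<open>'a \<times> nat\<close>, where \<open>'a\<close> is the type of the points of \<open>X\<close>. No Hilbert space
  is lost: a coarse embedding of \<open>X\<close> into any Hilbert space takes values in the closed linear span
  of its image, whose Hilbert dimension is at most the cardinality of \<open>'a \<times> nat\<close>, and which is
  therefore isometric to a subspace of this one (a complex Hilbert space is one over the reals
  with the same distance).\<close>

definition coarsely_embeds_into_Hilbert :: "'a set \<Rightarrow> ('a \<Rightarrow> 'a \<Rightarrow> real) \<Rightarrow> bool" where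
  "coarsely_embeds_into_Hilbert X d \<longleftrightarrow>
     (\<exists>f :: 'a \<Rightarrow> ('a \<times> nat) ell2. coarse_embedding X d UNIV dist f)"

end

theory Submission
  imports Defs
begin

text \<open>Every matching has \<open>2 * n\<close> pairs, so the Wasserstein distance lies between the bottleneck distance
  and \<open>2 * n\<close> times it. Asymptotic dimension and coarse embeddability do not change under such a
  comparison (\<open>asdim_le_lipschitz_equiv\<close>, \<open>coarse_embedding_lipschitz_equiv\<close>), and everything is proved
  for the bottleneck distance.

  The upper bound and the embedding come from one family of partitions. Birth and persistence of a point
  are rounded to blocks of length \<open>e\<close>, and, for each colour \<open>k < N\<close>, the blocks are joined to cells of \<open>N\<close>
  blocks that start at the block numbers congruent to \<open>k\<close> modulo \<open>N\<close>. A diagram is classified by the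
  multiset of the cells of its points. This is invariant under permutations, which makes it a function
  of the diagram. Diagrams of the same class are at distance at most \<open>2 * e * N\<close> (\<open>same_cells_close\<close>),
  and the colour \<open>k\<close> separates two diagrams only if the start of a block with number congruent to \<open>k\<close>
  lies between a point and its partner (\<open>cells_ne_imp_crossed\<close>).

  For the upper bound on the dimension take \<open>N = 2 * n + 1\<close>. The \<open>2 * n\<close> coordinates of a diagram leave
  some residue \<open>k\<close> free; this is its colour. Between a point and a partner at distance less than \<open>e / 2\<close>
  there is no block start except that of a block containing one of the two, so close diagrams of colour
  \<open>k\<close> have the same class (\<open>asdim_le_bottleneck\<close>).

  For the embedding take \<open>N = 2 ^ j\<close> for all \<open>j\<close>, and \<open>k\<close> at random. Two diagrams at distance \<open>d\<close> are
  separated at scale \<open>j\<close> with probability \<open>O((d + 1) / 2 ^ j)\<close>, which is summable, and certainly if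
  \<open>2 ^ (j + 1) < d\<close>. Such random partitions of any space give a coarse embedding by the indicators of their
  pieces (\<open>random_partitions_imp_coarse_embedding\<close>).

  For the lower bound, the space of diagrams contains arbitrarily large \<open>2 * n\<close>-dimensional grids with the
  maximum distance (\<open>grid_tuple\<close>). If such a grid has at most \<open>2 * n\<close> colours, then by Kuhn's lemma,
  the combinatorial core of Brouwer's theorem, some monochromatic piece joins two opposite faces
  (\<open>coloured_grid_has_crossing\<close>), which contradicts uniform boundedness.\<close>

section \<open>Matchings\<close>

lemma delta_nonneg: "x \<in> D1 \<Longrightarrow> y \<in> D1 \<Longrightarrow> 0 \<le> delta x y"
  by (cases x; cases y) (auto simp: D1_def T_def dinf_def)

lemma pad_in_D1: "z \<in> tuples n \<Longrightarrow> i \<in> {1..2*n} \<Longrightarrow> pad n z i \<in> D1"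
  by (auto simp: pad_def tuples_def D1_def dest: PiE_mem)

lemma permuted_pad_in_D1:
  "z \<in> tuples n \<Longrightarrow> \<phi> permutes {1..2*n} \<Longrightarrow> i \<in> {1..2*n} \<Longrightarrow> pad n z (\<phi> i) \<in> D1"
  by (rule pad_in_D1) (simp_all only: permutes_in_image)

lemma tuple_bottleneck_le_iff:
  assumes "n \<ge> 1"
  shows "tuple_bottleneck n z z' \<le> B \<longleftrightarrow>
    (\<exists>\<phi>. \<phi> permutes {1..2*n} \<and> (\<forall>i\<in>{1..2*n}. delta (pad n z i) (pad n z' (\<phi> i)) \<le> B))"
proof -
  let ?P = "{\<phi>. \<phi> permutes {1..2*n}}"
  have P: "finite ?P" "?P \<noteq> {}" using finite_permutations[of "{1..2*n}"] permutes_id[of "{1..2*n}"] by blast+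
  have ne: "{1..2*n} \<noteq> {}" using assms by simp
  show ?thesis
    unfolding tuple_bottleneck_def using P ne by (subst Min_le_iff) (auto simp: Max_le_iff)
qed

lemma optimal_matching:
  assumes "n \<ge> 1"
  obtains \<phi> where "\<phi> permutes {1..2*n}"
    "\<forall>i\<in>{1..2*n}. delta (pad n z i) (pad n z' (\<phi> i)) \<le> tuple_bottleneck n z z'"
  using tuple_bottleneck_le_iff[OF assms, of z z' "tuple_bottleneck n z z'"] by auto

lemma tuple_bottleneck_nonneg:
  assumes "n \<ge> 1" "z \<in> tuples n" "z' \<in> tuples n"
  shows "0 \<le> tuple_bottleneck n z z'"
proof -
  obtain \<phi> where \<phi>: "\<phi> permutes {1..2*n}"
    "\<forall>i\<in>{1..2*n}. delta (pad n z i) (pad n z' (\<phi> i)) \<le> tuple_bottleneck n z z'"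
    using optimal_matching[OF assms(1)] .
  have 1: "1 \<in> {1..2*n}" using assms(1) by simp
  have "0 \<le> delta (pad n z 1) (pad n z' (\<phi> 1))"
    using delta_nonneg[OF pad_in_D1[OF assms(2) 1] permuted_pad_in_D1[OF assms(3) \<phi>(1) 1]] .
  also have "\<dots> \<le> tuple_bottleneck n z z'" using \<phi>(2) 1 by blast
  finally show ?thesis .
qed

text \<open>Whether two points are matched to each other or each of them to the diagonal can be decided
  pair by pair, because both tuples are padded with as many copies of \<open>\<Delta>\<close> as they have entries.\<close>

lemma tuple_bottleneck_leI:
  assumes n: "n \<ge> 1" and B: "B \<ge> 0" and \<psi>: "\<psi> permutes {1..n}"
    and match: "\<And>i. i \<in> {1..n} \<Longrightarrow> delta (z i) (z' (\<psi> i)) \<le> B \<or>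
                  (delta (z i) None \<le> B \<and> delta None (z' (\<psi> i)) \<le> B)"
  shows "tuple_bottleneck n z z' \<le> B"
proof -
  define A where "A = {i\<in>{1..n}. delta (z i) (z' (\<psi> i)) \<le> B}"
  \<comment> \<open>Slot \<open>n + i\<close> is the reserve of slot \<open>i\<close>: outside of \<open>A\<close> the targets of the two are swapped.\<close>
  define \<phi> where "\<phi> i = (if i \<in> {1..n} then (if i \<in> A then \<psi> i else n + \<psi> i)
      else if i \<in> {n+1..2*n} then (if i - n \<in> A then n + \<psi> (i - n) else \<psi> (i - n)) else i)" for i
  have \<psi>_in: "\<psi> i \<in> {1..n} \<longleftrightarrow> i \<in> {1..n}" for i using permutes_in_image[OF \<psi>] .
  have \<psi>_inj: "\<psi> i = \<psi> j \<longleftrightarrow> i = j" for i j using permutes_inj[OF \<psi>] by (auto dest: injD)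
  have low: "\<phi> i = (if i \<in> A then \<psi> i else n + \<psi> i)" if "i \<in> {1..n}" for i
    using that by (simp add: \<phi>_def)
  have high: "\<phi> (n + i) = (if i \<in> A then n + \<psi> i else \<psi> i)" if "i \<in> {1..n}" for i
    using that by (simp add: \<phi>_def)
  have split: "i \<in> {1..n} \<or> (\<exists>j\<in>{1..n}. i = n + j)" if "i \<in> {1..2*n}" for i
  proof (cases "i \<le> n")
    case False
    then have "i - n \<in> {1..n}" "i = n + (i - n)" using that by auto
    then show ?thesis by blast
  qed (use that in auto)
  have \<psi>_range: "1 \<le> \<psi> i" "\<psi> i \<le> n" if "i \<in> {1..n}" for i
    using \<psi>_in[of i] that by simp_all
  have in_range: "\<phi> i \<in> {1..2*n}" if i: "i \<in> {1..2*n}" for i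
  proof (cases "i \<in> {1..n}")
    case True
    show ?thesis using low[OF True] \<psi>_range[OF True] by (simp split: if_splits)
  next
    case False
    then obtain j where j: "j \<in> {1..n}" "i = n + j" using split[OF i] by blast
    show ?thesis using high[OF j(1)] \<psi>_range[OF j(1)] j(2) by (simp split: if_splits)
  qed
  have "inj_on \<phi> {1..2*n}"
  proof (rule inj_onI)
    fix i j assume i: "i \<in> {1..2*n}" and j: "j \<in> {1..2*n}" and eq: "\<phi> i = \<phi> j"
    consider "i \<in> {1..n}" "j \<in> {1..n}"
      | b where "i \<in> {1..n}" "b \<in> {1..n}" "j = n + b"
      | a where "a \<in> {1..n}" "i = n + a" "j \<in> {1..n}"
      | a b where "a \<in> {1..n}" "i = n + a" "b \<in> {1..n}" "j = n + b"
      using split[OF i] split[OF j] by blast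
    then show "i = j"
    proof cases
      case 1
      then have "\<psi> i = \<psi> j"
        using eq[unfolded low[OF 1(1)] low[OF 1(2)]] \<psi>_range[OF 1(1)] \<psi>_range[OF 1(2)]
        by (cases "i \<in> A"; cases "j \<in> A") simp_all
      then show ?thesis by (simp add: \<psi>_inj)
    next
      case (2 b)
      then have "\<psi> i = \<psi> b" "i \<in> A \<longleftrightarrow> b \<notin> A"
        using eq[unfolded 2(3) low[OF 2(1)] high[OF 2(2)]] \<psi>_range[OF 2(1)] \<psi>_range[OF 2(2)]
        by (cases "i \<in> A"; cases "b \<in> A"; simp)+
      then show ?thesis by (simp add: \<psi>_inj)
    next
      case (3 a)
      then have "\<psi> a = \<psi> j" "a \<in> A \<longleftrightarrow> j \<notin> A"
        using eq[unfolded 3(2) low[OF 3(3)] high[OF 3(1)]] \<psi>_range[OF 3(1)] \<psi>_range[OF 3(3)]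
        by (cases "a \<in> A"; cases "j \<in> A"; simp)+
      then show ?thesis by (simp add: \<psi>_inj)
    next
      case (4 a b)
      then have "\<psi> a = \<psi> b"
        using eq[unfolded 4(2,4) high[OF 4(1)] high[OF 4(3)]] \<psi>_range[OF 4(1)] \<psi>_range[OF 4(3)]
        by (cases "a \<in> A"; cases "b \<in> A") simp_all
      then show ?thesis using 4 by (simp add: \<psi>_inj)
    qed
  qed
  moreover have "\<phi> ` {1..2*n} \<subseteq> {1..2*n}" using in_range by blast
  ultimately have "bij_betw \<phi> {1..2*n} {1..2*n}"
    by (simp add: bij_betw_def endo_inj_surj)
  moreover have "\<phi> i = i" if "i \<notin> {1..2*n}" for i using that by (auto simp: \<phi>_def)
  ultimately have "\<phi> permutes {1..2*n}" by (rule bij_imp_permutes)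
  moreover have "delta (pad n z i) (pad n z' (\<phi> i)) \<le> B" if i: "i \<in> {1..2*n}" for i
  proof (cases "i \<in> {1..n}")
    case True
    have "delta (z i) (z' (\<psi> i)) \<le> B" if "i \<in> A" using that by (simp add: A_def)
    moreover have "delta (z i) None \<le> B" if "i \<notin> A" using that True match[OF True] by (simp add: A_def)
    ultimately show ?thesis using True low[OF True] \<psi>_range[OF True] by (simp add: pad_def)
  next
    case False
    then obtain j where j: "j \<in> {1..n}" "i = n + j" using split[OF i] by blast
    have "delta None (z' (\<psi> j)) \<le> B" if "j \<notin> A" using that j match[OF j(1)] by (simp add: A_def)
    then show ?thesis using B j \<psi>_range[OF j(1)] high[OF j(1)] by (simp add: pad_def)
  qed
  ultimately show ?thesis unfolding tuple_bottleneck_le_iff[OF n] by blast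
qed

lemma tuple_bottleneck_le_wasserstein:
  assumes n: "n \<ge> 1" and p: "p > 0" and z: "z \<in> tuples n" "z' \<in> tuples n"
  shows "tuple_bottleneck n z z' \<le> tuple_wasserstein n p z z'"
proof -
  let ?P = "{\<phi>. \<phi> permutes {1..2*n}}"
  have P: "finite ?P" "?P \<noteq> {}" using finite_permutations[of "{1..2*n}"] permutes_id[of "{1..2*n}"] by blast+
  have "tuple_bottleneck n z z' \<le> (\<Sum>i=1..2*n. delta (pad n z i) (pad n z' (\<phi> i)) powr p) powr (1 / p)"
    if \<phi>: "\<phi> permutes {1..2*n}" for \<phi>
  proof -
    let ?d = "\<lambda>i. delta (pad n z i) (pad n z' (\<phi> i))"
    have nn: "0 \<le> ?d i" if "i \<in> {1..2*n}" for i
      using delta_nonneg[OF pad_in_D1[OF z(1) that] permuted_pad_in_D1[OF z(2) \<phi> that]] .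
    have "?d i \<le> (\<Sum>i=1..2*n. ?d i powr p) powr (1 / p)" if i: "i \<in> {1..2*n}" for i
    proof -
      have "?d i powr p \<le> (\<Sum>i=1..2*n. ?d i powr p)"
        by (rule member_le_sum[OF i]) auto
      then have "(?d i powr p) powr (1 / p) \<le> (\<Sum>i=1..2*n. ?d i powr p) powr (1 / p)"
        using p by (intro powr_mono2) auto
      then show ?thesis using nn[OF i] p by (simp add: powr_powr)
    qed
    then show ?thesis using \<phi> by (subst tuple_bottleneck_le_iff[OF n]) blast
  qed
  then show ?thesis unfolding tuple_wasserstein_def using P by (subst Min_ge_iff) auto
qed

lemma tuple_wasserstein_le_bottleneck:
  assumes n: "n \<ge> 1" and p: "p \<ge> 1" and z: "z \<in> tuples n" "z' \<in> tuples n"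
  shows "tuple_wasserstein n p z z' \<le> 2 * n * tuple_bottleneck n z z'"
proof -
  let ?b = "tuple_bottleneck n z z'"
  have b: "0 \<le> ?b" using tuple_bottleneck_nonneg[OF n z] .
  obtain \<phi> where \<phi>: "\<phi> permutes {1..2*n}"
    and le: "\<forall>i\<in>{1..2*n}. delta (pad n z i) (pad n z' (\<phi> i)) \<le> ?b"
    using optimal_matching[OF n] .
  let ?d = "\<lambda>i. delta (pad n z i) (pad n z' (\<phi> i))"
  have nn: "0 \<le> ?d i" if "i \<in> {1..2*n}" for i
    using delta_nonneg[OF pad_in_D1[OF z(1) that] permuted_pad_in_D1[OF z(2) \<phi> that]] .
  have "tuple_wasserstein n p z z' \<le> (\<Sum>i=1..2*n. ?d i powr p) powr (1 / p)"
    unfolding tuple_wasserstein_def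
    by (rule Min_le[OF finite_imageI[OF finite_permutations]]) (use \<phi> in simp_all)
  also have "\<dots> \<le> (\<Sum>i=1..2*n. ?b powr p) powr (1 / p)"
  proof (rule powr_mono2)
    show "(\<Sum>i=1..2*n. ?d i powr p) \<le> (\<Sum>i=1..2*n. ?b powr p)"
    proof (rule sum_mono)
      fix i assume i: "i \<in> {1..2*n}"
      show "?d i powr p \<le> ?b powr p" using powr_mono2[OF _ nn[OF i] bspec[OF le i]] p by simp
    qed
  qed (use p in \<open>simp_all add: sum_nonneg\<close>)
  also have "\<dots> = (2 * n) powr (1 / p) * ?b"
    using b p by (simp add: powr_mult powr_powr)
  also have "\<dots> \<le> (2 * n) powr 1 * ?b"
    using p n by (intro mult_right_mono[OF _ b] powr_mono) simp_all
  also have "\<dots> = 2 * n * ?b" using n by simp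
  finally show ?thesis by simp
qed

lemma representative_in_tuples:
  assumes "Z \<in> diagrams n"
  shows "(SOME z. z \<in> Z) \<in> tuples n"
proof -
  have Z: "Z \<in> tuples n // perm_rel n" using assms by (simp add: diagrams_def)
  have "(SOME z. z \<in> Z) \<in> Z"
    using in_quotient_imp_non_empty[OF equiv_perm_rel Z] by (simp add: some_in_eq)
  then show ?thesis using in_quotient_imp_subset[OF equiv_perm_rel Z] by (rule rev_subsetD)
qed

lemma bottleneck_dist_nonneg:
  "n \<ge> 1 \<Longrightarrow> Z \<in> diagrams n \<Longrightarrow> Z' \<in> diagrams n \<Longrightarrow> 0 \<le> bottleneck_dist n Z Z'"
  by (simp add: bottleneck_dist_def representative_in_tuples tuple_bottleneck_nonneg)

section \<open>Lipschitz equivalent distances\<close>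

text \<open>One direction uses families for the same \<open>R\<close>, the other one families for \<open>K * R\<close>.\<close>

lemma asdim_le_lipschitz_equiv:
  assumes K: "K > 0"
    and le: "\<And>x y. x \<in> X \<Longrightarrow> y \<in> X \<Longrightarrow> d x y \<le> d' x y"
    and ge: "\<And>x y. x \<in> X \<Longrightarrow> y \<in> X \<Longrightarrow> d' x y \<le> K * d x y"
  shows "asdim_le X d m \<longleftrightarrow> asdim_le X d' m"
proof
  assume L: "asdim_le X d m"
  show "asdim_le X d' m"
    unfolding asdim_le_def
  proof (intro allI impI)
    fix R :: real assume "R > 0"
    then obtain Xs where Xs: "X = (\<Union>i\<le>m. Xs i)"
      and U: "\<forall>i\<le>m. \<exists>\<U>. Xs i = \<Union>\<U> \<and> uniformly_bounded d \<U> \<and> R_disjoint d R \<U>"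
      using L unfolding asdim_le_def by blast
    have "\<exists>\<U>. Xs i = \<Union>\<U> \<and> uniformly_bounded d' \<U> \<and> R_disjoint d' R \<U>" if i: "i \<le> m" for i
    proof -
      obtain \<U> B where V: "Xs i = \<Union>\<U>" "R_disjoint d R \<U>"
        and B: "\<forall>U\<in>\<U>. \<forall>x\<in>U. \<forall>y\<in>U. d x y \<le> B"
        using U i unfolding uniformly_bounded_def by metis
      have sub: "x \<in> X" if "x \<in> U" "U \<in> \<U>" for x U using that V(1) Xs i by blast
      have "d' x y \<le> K * B" if "U \<in> \<U>" "x \<in> U" "y \<in> U" for U x y
      proof -
        have "d' x y \<le> K * d x y" using ge sub that by blast
        also have "\<dots> \<le> K * B" using B that K by simp
        finally show ?thesis .
      qed
      moreover have "d' x y \<ge> R" if "U \<in> \<U>" "V \<in> \<U>" "U \<noteq> V" "x \<in> U" "y \<in> V" for U V x y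
      proof -
        have "R \<le> d x y" using V(2) that unfolding R_disjoint_def by blast
        also have "\<dots> \<le> d' x y" using le sub that by blast
        finally show ?thesis .
      qed
      then have "R_disjoint d' R \<U>" unfolding R_disjoint_def by blast
      ultimately show ?thesis using V(1) unfolding uniformly_bounded_def by blast
    qed
    with Xs show "\<exists>Xs. X = (\<Union>i\<le>m. Xs i) \<and>
        (\<forall>i\<le>m. \<exists>\<U>. Xs i = \<Union>\<U> \<and> uniformly_bounded d' \<U> \<and> R_disjoint d' R \<U>)" by blast
  qed
next
  assume L: "asdim_le X d' m"
  show "asdim_le X d m"
    unfolding asdim_le_def
  proof (intro allI impI)
    fix R :: real assume "R > 0"
    then have "K * R > 0" using K by simp
    then obtain Xs where Xs: "X = (\<Union>i\<le>m. Xs i)"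
      and U: "\<forall>i\<le>m. \<exists>\<U>. Xs i = \<Union>\<U> \<and> uniformly_bounded d' \<U> \<and> R_disjoint d' (K * R) \<U>"
      using L unfolding asdim_le_def by blast
    have "\<exists>\<U>. Xs i = \<Union>\<U> \<and> uniformly_bounded d \<U> \<and> R_disjoint d R \<U>" if i: "i \<le> m" for i
    proof -
      obtain \<U> B where V: "Xs i = \<Union>\<U>" "R_disjoint d' (K * R) \<U>"
        and B: "\<forall>U\<in>\<U>. \<forall>x\<in>U. \<forall>y\<in>U. d' x y \<le> B"
        using U i unfolding uniformly_bounded_def by metis
      have sub: "x \<in> X" if "x \<in> U" "U \<in> \<U>" for x U using that V(1) Xs i by blast
      have "d x y \<le> B" if "U \<in> \<U>" "x \<in> U" "y \<in> U" for U x y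
      proof -
        have "d x y \<le> d' x y" using le sub that by blast
        also have "\<dots> \<le> B" using B that by blast
        finally show ?thesis .
      qed
      moreover have "d x y \<ge> R" if "U \<in> \<U>" "V \<in> \<U>" "U \<noteq> V" "x \<in> U" "y \<in> V" for U V x y
      proof -
        have "K * R \<le> d' x y" using V(2) that unfolding R_disjoint_def by blast
        also have "\<dots> \<le> K * d x y" using ge sub that by blast
        finally show ?thesis using K by simp
      qed
      then have "R_disjoint d R \<U>" unfolding R_disjoint_def by blast
      ultimately show ?thesis using V(1) unfolding uniformly_bounded_def by blast
    qed
    with Xs show "\<exists>Xs. X = (\<Union>i\<le>m. Xs i) \<and>
        (\<forall>i\<le>m. \<exists>\<U>. Xs i = \<Union>\<U> \<and> uniformly_bounded d \<U> \<and> R_disjoint d R \<U>)" by blast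
  qed
qed

lemma coarse_embedding_lipschitz_equiv:
  assumes K: "K > 0"
    and nn: "\<And>x y. x \<in> X \<Longrightarrow> y \<in> X \<Longrightarrow> 0 \<le> d x y"
    and le: "\<And>x y. x \<in> X \<Longrightarrow> y \<in> X \<Longrightarrow> d x y \<le> d' x y"
    and ge: "\<And>x y. x \<in> X \<Longrightarrow> y \<in> X \<Longrightarrow> d' x y \<le> K * d x y"
    and emb: "coarse_embedding X d Y dY f"
  shows "coarse_embedding X d' Y dY f"
proof -
  obtain \<rho>1 \<rho>2 :: "real \<Rightarrow> real" where f: "f \<in> X \<rightarrow> Y"
    and \<rho>: "\<rho>1 \<in> {0..} \<rightarrow> {0..}" "\<rho>2 \<in> {0..} \<rightarrow> {0..}"
      "mono_on {0..} \<rho>1" "mono_on {0..} \<rho>2" "filterlim \<rho>1 at_top at_top"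
    and bd: "\<forall>x\<in>X. \<forall>y\<in>X. \<rho>1 (d x y) \<le> dY (f x) (f y) \<and> dY (f x) (f y) \<le> \<rho>2 (d x y)"
    using emb unfolding coarse_embedding_def by blast
  let ?\<rho> = "\<lambda>t. \<rho>1 (t / K)"
  have "filterlim (\<lambda>t. t / K) at_top at_top"
    using filterlim_tendsto_pos_mult_at_top[OF tendsto_const[of "1/K"] _ filterlim_ident] K
    by (simp add: mult.commute)
  then have lim: "filterlim ?\<rho> at_top at_top" by (rule filterlim_compose[OF \<rho>(5)])
  have "?\<rho> (d' x y) \<le> dY (f x) (f y) \<and> dY (f x) (f y) \<le> \<rho>2 (d' x y)" if xy: "x \<in> X" "y \<in> X" for x y
  proof -
    have "0 \<le> d x y" "0 \<le> d' x y" using nn[OF xy] le[OF xy] by linarith+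
    moreover have "d' x y / K \<le> d x y" using ge[OF xy] K by (simp add: field_simps)
    ultimately have "?\<rho> (d' x y) \<le> \<rho>1 (d x y)" "\<rho>2 (d x y) \<le> \<rho>2 (d' x y)"
      using K le[OF xy] by (auto intro!: mono_onD[OF \<rho>(3)] mono_onD[OF \<rho>(4)])
    then show ?thesis using bd[rule_format, OF xy] by linarith
  qed
  moreover have "?\<rho> \<in> {0..} \<rightarrow> {0..}" "mono_on {0..} ?\<rho>"
    using \<rho>(1) K by (auto intro!: mono_onI mono_onD[OF \<rho>(3)] divide_right_mono)
  ultimately show ?thesis
    unfolding coarse_embedding_def using f \<rho>(2,4) lim by blast
qed

section \<open>Cells\<close>

text \<open>A point is described by its birth \<open>a\<close> and its persistence \<open>b - a\<close>; the persistence, unlike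
  the death \<open>b\<close>, tells how far the diagonal is. The line is cut into blocks of length \<open>e\<close>, and
  \<open>levels\<close> gives the numbers of the blocks that contain the two coordinates.\<close>

fun levels :: "real \<Rightarrow> dgm_point \<Rightarrow> int set" where
  "levels e None = {}"
| "levels e (Some (a, b)) = {\<lfloor>a / e\<rfloor>, \<lfloor>(b - a) / e\<rfloor>}"

text \<open>For the colour \<open>k\<close> the blocks are joined to cells of \<open>N\<close> consecutive blocks, each starting at a
  block number congruent to \<open>k\<close> modulo \<open>N\<close>. Points whose persistence lies before the first such start
  share the cell of \<open>\<Delta>\<close>, whatever their birth: near the diagonal, points with distant births are
  close to \<open>\<Delta>\<close>, hence close to each other in diagram space.\<close>

fun cell :: "real \<Rightarrow> int \<Rightarrow> int \<Rightarrow> dgm_point \<Rightarrow> (int \<times> int) option" where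
  "cell e N k None = None"
| "cell e N k (Some (a, b)) =
     (let h = (\<lfloor>(b - a) / e\<rfloor> - k) div N
      in if h < 0 then None else Some (h, (\<lfloor>a / e\<rfloor> - k) div N))"

definition between :: "int \<Rightarrow> int \<Rightarrow> int set" where
  "between q q' = {min q q'<..max q q'}"

text \<open>The numbers of the blocks whose start lies between the two points, in either coordinate. The point \<open>\<Delta>\<close>
  counts as block number \<open>-1\<close> of the persistence axis, so that block \<open>0\<close> belongs to the interval: with
  colour \<open>0\<close>, every point off the diagonal lies in another cell than \<open>\<Delta>\<close>.\<close>

fun crossed :: "real \<Rightarrow> dgm_point \<Rightarrow> dgm_point \<Rightarrow> int set" where
  "crossed e (Some (a, b)) (Some (c, d)) =
     between \<lfloor>a / e\<rfloor> \<lfloor>c / e\<rfloor> \<union> between \<lfloor>(b - a) / e\<rfloor> \<lfloor>(d - c) / e\<rfloor>"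
| "crossed e (Some (a, b)) None = {0..\<lfloor>(b - a) / e\<rfloor>}"
| "crossed e None (Some (c, d)) = {0..\<lfloor>(d - c) / e\<rfloor>}"
| "crossed e None None = {}"

text \<open>The cells start exactly at the block numbers congruent to \<open>k\<close>, so two blocks in different
  cells have one of these between them.\<close>

lemma div_ne_imp_between:
  fixes q q' k N :: int
  assumes N: "0 < N" and k: "0 \<le> k" "k < N" and ne: "(q - k) div N \<noteq> (q' - k) div N"
  shows "\<exists>r\<in>between q q'. r mod N = k"
proof -
  have *: "\<exists>r. u < r \<and> r \<le> v \<and> r mod N = k" if "(u - k) div N \<noteq> (v - k) div N" "u \<le> v" for u v
  proof (intro exI conjI)
    let ?r = "N * ((v - k) div N) + k"
    have "(u - k) div N < (v - k) div N"
      using that zdiv_mono1[of "u - k" "v - k" N] N by simp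
    then have "N * ((u - k) div N + 1) \<le> N * ((v - k) div N)" using N by (intro mult_left_mono) auto
    moreover have "u - k < N * ((u - k) div N + 1)"
      using mult_div_mod_eq[of N "u - k"] pos_mod_bound[OF N, of "u - k"]
      unfolding distrib_left mult_1_right by linarith
    ultimately have "u - k < N * ((v - k) div N)" by linarith
    then show "u < ?r" by simp
    show "?r \<le> v" using N mult_div_mod_eq[of N "v - k"] pos_mod_sign[of N "v - k"] by linarith
    show "?r mod N = k" using k by simp
  qed
  show ?thesis
    using *[of q q'] *[of q' q] ne unfolding between_def by (cases "q \<le> q'") auto
qed

lemma cell_ne_imp_crossed:
  assumes N: "0 < N" and k: "0 \<le> k" "k < N" and ne: "cell e N k x \<noteq> cell e N k y"
  shows "\<exists>r\<in>crossed e x y. r mod N = k"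
proof -
  have diag: "\<exists>r\<in>{0..q}. r mod N = k" if "(q - k) div N \<ge> 0" for q
  proof -
    have "q - k \<ge> 0" using that N by (meson not_le div_neg_pos_less0)
    then show ?thesis using k by (intro bexI[of _ k]) auto
  qed
  show ?thesis
  proof (cases x; cases y)
    assume "x = None" "y = None" then show ?thesis using ne by simp
  next
    fix v assume "x = None" "y = Some v"
    then show ?thesis using ne diag by (cases v) (auto simp: Let_def split: if_splits)
  next
    fix u assume "x = Some u" "y = None"
    then show ?thesis using ne diag by (cases u) (auto simp: Let_def split: if_splits)
  next
    fix u v assume xy: "x = Some u" "y = Some v"
    obtain a b c d where uv: "u = (a, b)" "v = (c, d)" by (cases u; cases v)
    then have "(\<lfloor>a/e\<rfloor> - k) div N \<noteq> (\<lfloor>c/e\<rfloor> - k) div N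
         \<or> (\<lfloor>(b - a)/e\<rfloor> - k) div N \<noteq> (\<lfloor>(d - c)/e\<rfloor> - k) div N"
      using ne xy by (metis cell.simps(2))
    then show ?thesis using div_ne_imp_between[OF N k] xy uv by fastforce
  qed
qed

lemma floor_diff_le:
  fixes s t :: real
  shows "real_of_int \<bar>\<lfloor>s\<rfloor> - \<lfloor>t\<rfloor>\<bar> \<le> \<bar>s - t\<bar> + 1"
  by linarith

lemma card_between: "int (card (between q q')) = \<bar>q - q'\<bar>"
  by (auto simp: between_def)

lemma persistence_diff_le:
  "\<bar>(b - a) - (d - c)\<bar> \<le> 2 * delta (Some (a, b)) (Some (c, d))"
proof -
  have "\<bar>(b - a) - (d - c)\<bar> \<le> \<bar>a - c\<bar> + \<bar>b - d\<bar>" by linarith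
  also have "\<dots> \<le> 2 * max \<bar>a - c\<bar> \<bar>b - d\<bar>"
    using max.cobounded1[of "\<bar>a - c\<bar>" "\<bar>b - d\<bar>"] max.cobounded2[of "\<bar>b - d\<bar>" "\<bar>a - c\<bar>"] by linarith
  finally show ?thesis by (simp add: dinf_def)
qed

text \<open>A matched pair at distance \<open>\<delta>\<close> crosses about \<open>\<delta> / e\<close> blocks in its birth and \<open>2 * \<delta> / e\<close> in its
  persistence. So it is separated by only a few of the \<open>N\<close> colours.\<close>

lemma card_crossed:
  assumes e: "e > 0" and xy: "x \<in> D1" "y \<in> D1"
  shows "finite (crossed e x y)" "real (card (crossed e x y)) \<le> 3 * (delta x y / e) + 2"
proof -
  show "finite (crossed e x y)"
    by (cases "(e, x, y)" rule: crossed.cases) (auto simp: between_def)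
  have pt: "real (card (between \<lfloor>s/e\<rfloor> \<lfloor>t/e\<rfloor>)) \<le> \<bar>s - t\<bar> / e + 1" for s t
  proof -
    have "real (card (between \<lfloor>s/e\<rfloor> \<lfloor>t/e\<rfloor>)) = real_of_int \<bar>\<lfloor>s/e\<rfloor> - \<lfloor>t/e\<rfloor>\<bar>"
      using card_between[of "\<lfloor>s/e\<rfloor>" "\<lfloor>t/e\<rfloor>"] by (metis of_int_of_nat_eq)
    also have "\<dots> \<le> \<bar>s/e - t/e\<bar> + 1" by (rule floor_diff_le)
    also have "\<bar>s/e - t/e\<bar> = \<bar>s - t\<bar> / e" using e by (simp flip: diff_divide_distrib)
    finally show ?thesis .
  qed
  have diag: "real (card {0..\<lfloor>w/e\<rfloor>}) \<le> 3 * (w / 2 / e) + 2" if "w > 0" for w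
  proof -
    have "0 < w / e" using that e by simp
    moreover from this have "real (card {0..\<lfloor>w/e\<rfloor>}) = real_of_int \<lfloor>w/e\<rfloor> + 1" by simp
    ultimately show ?thesis by linarith
  qed
  show "real (card (crossed e x y)) \<le> 3 * (delta x y / e) + 2"
  proof (cases "(e, x, y)" rule: crossed.cases)
    case (1 e' a b c d)
    let ?\<delta> = "delta x y"
    have "card (crossed e x y) \<le> card (between \<lfloor>a/e\<rfloor> \<lfloor>c/e\<rfloor>) + card (between \<lfloor>(b-a)/e\<rfloor> \<lfloor>(d-c)/e\<rfloor>)"
      using 1 by (simp add: card_Un_le)
    also have "real \<dots> \<le> (\<bar>a - c\<bar> / e + 1) + (\<bar>(b - a) - (d - c)\<bar> / e + 1)"
      using pt[of a c] pt[of "b - a" "d - c"] by simp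
    also have "\<dots> \<le> (?\<delta> / e + 1) + (2 * ?\<delta> / e + 1)"
      using e 1 persistence_diff_le[of b a d c] by (intro add_mono divide_right_mono) (auto simp: dinf_def)
    finally show ?thesis by simp
  next
    case (2 e' a b)
    then show ?thesis using diag[of "b - a"] xy by (simp add: D1_def T_def image_iff)
  next
    case (3 e' c d)
    then show ?thesis using diag[of "d - c"] xy by (simp add: D1_def T_def image_iff)
  qed (use e in simp)
qed

text \<open>At a distance below \<open>e / 2\<close> both coordinates change by less than \<open>e\<close>, so at most
  one block start lies between the two values, and it belongs to the block of the larger one.\<close>

lemma crossed_subset_levels:
  assumes e: "e > 0" and xy: "x \<in> D1" "y \<in> D1" and close: "delta x y < e / 2"
  shows "crossed e x y \<subseteq> levels e x \<union> levels e y"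
proof -
  have pt: "between \<lfloor>s/e\<rfloor> \<lfloor>t/e\<rfloor> \<subseteq> {\<lfloor>s/e\<rfloor>, \<lfloor>t/e\<rfloor>}" if "\<bar>s - t\<bar> < e" for s t
  proof -
    have "\<bar>s/e - t/e\<bar> < 1" using that e by (simp flip: diff_divide_distrib)
    then have "\<bar>\<lfloor>s/e\<rfloor> - \<lfloor>t/e\<rfloor>\<bar> \<le> 1" by linarith
    then show ?thesis by (auto simp: between_def)
  qed
  have diag: "\<lfloor>w/e\<rfloor> = 0" if "0 < w" "w < e" for w
    using that e by (simp add: floor_eq_iff)
  show ?thesis
  proof (cases "(e, x, y)" rule: crossed.cases)
    case (1 e' a b c d)
    have "\<bar>a - c\<bar> \<le> delta x y" using 1 by (simp add: dinf_def)
    then have "\<bar>a - c\<bar> < e" using close e by linarith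
    moreover have "\<bar>(b - a) - (d - c)\<bar> < e"
      using close 1 persistence_diff_le[of b a d c] by auto
    ultimately show ?thesis using pt[of a c] pt[of "b - a" "d - c"] 1 by auto
  qed (use close xy diag in \<open>auto simp: D1_def T_def\<close>)
qed

text \<open>The two alternatives are the case of a proper cell and the case of the cell of \<open>\<Delta>\<close>, where the points
  may be far apart in the plane but both are close to the diagonal.\<close>

lemma same_cell_close:
  assumes e: "e > 0" and N: "0 < N" and k: "0 \<le> k" "k < N"
    and xy: "x \<in> D1" "y \<in> D1" and eq: "cell e N k x = cell e N k y"
  shows "delta x y \<le> 2 * e * N \<or> (delta x None \<le> 2 * e * N \<and> delta None y \<le> 2 * e * N)"
proof -
  have eN: "e * N > 0" using e N by simp
  have near: "\<bar>s - t\<bar> \<le> e * N" if "(\<lfloor>s/e\<rfloor> - k) div N = (\<lfloor>t/e\<rfloor> - k) div N" for s t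
  proof -
    have "\<bar>\<lfloor>s/e\<rfloor> - \<lfloor>t/e\<rfloor>\<bar> < N"
      using that N mult_div_mod_eq[of N "\<lfloor>s/e\<rfloor> - k"] mult_div_mod_eq[of N "\<lfloor>t/e\<rfloor> - k"]
        pos_mod_bound[OF N, of "\<lfloor>s/e\<rfloor> - k"] pos_mod_sign[OF N, of "\<lfloor>s/e\<rfloor> - k"]
        pos_mod_bound[OF N, of "\<lfloor>t/e\<rfloor> - k"] pos_mod_sign[OF N, of "\<lfloor>t/e\<rfloor> - k"]
      by (smt (verit))
    then have "\<bar>s/e - t/e\<bar> \<le> N" by linarith
    then show ?thesis using e by (simp add: field_simps flip: diff_divide_distrib)
  qed
  have low: "w \<le> e * N" if "(\<lfloor>w/e\<rfloor> - k) div N < 0" for w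
  proof -
    have "\<lfloor>w/e\<rfloor> - k < 0" using that N by (meson not_le pos_imp_zdiv_nonneg_iff)
    then have "w/e \<le> N" using k by linarith
    then show ?thesis using e by (simp add: field_simps)
  qed
  have none: "delta z None \<le> 2 * e * N \<and> delta None z \<le> 2 * e * N" if "cell e N k z = None" for z
  proof (cases z)
    case (Some u)
    obtain a b where u: "u = (a, b)" by (cases u)
    have "b - a \<le> e * N" using that Some u by (intro low) (auto simp: Let_def split: if_splits)
    then show ?thesis using Some u eN by simp
  qed (use eN in simp)
  show ?thesis
  proof (cases "cell e N k x")
    case None
    then show ?thesis using none eq by metis
  next
    case (Some c)
    have "cell e N k y = Some c" using eq Some by simp
    with Some obtain a b c d where [simp]: "x = Some (a, b)" "y = Some (c, d)"
      by (cases x; cases y) auto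
    have "\<bar>a - c\<bar> \<le> e * N" "\<bar>(b - a) - (d - c)\<bar> \<le> e * N"
      using eq Some by (intro near; auto simp: Let_def split: if_splits)+
    then have "\<bar>a - c\<bar> \<le> 2 * (e * N)" "\<bar>b - d\<bar> \<le> 2 * (e * N)" by linarith+
    then show ?thesis by (simp add: dinf_def mult.assoc)
  qed
qed

definition cells :: "real \<Rightarrow> int \<Rightarrow> int \<Rightarrow> nat \<Rightarrow> (nat \<Rightarrow> dgm_point) \<Rightarrow> (int \<times> int) option multiset" where
  "cells e N k n z = image_mset (\<lambda>i. cell e N k (z i)) (mset_set {1..n})"

text \<open>Equal multisets of cells give a matching within cells; pairs in the cell of \<open>\<Delta>\<close> are rerouted to the
  diagonal by \<open>tuple_bottleneck_leI\<close>.\<close>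

lemma same_cells_close:
  assumes n: "n \<ge> 1" and e: "e > 0" and N: "0 < N" and k: "0 \<le> k" "k < N"
    and z: "z \<in> tuples n" "z' \<in> tuples n" and eq: "cells e N k n z = cells e N k n z'"
  shows "tuple_bottleneck n z z' \<le> 2 * e * N"
proof -
  obtain \<psi> where \<psi>: "\<psi> permutes {1..n}" "\<forall>i\<in>{1..n}. cell e N k (z i) = cell e N k (z' (\<psi> i))"
    using image_mset_eq_implies_permutes[OF _ eq[unfolded cells_def]] by blast
  have "z i \<in> D1" "z' (\<psi> i) \<in> D1" if "i \<in> {1..n}" for i
    using that z permutes_in_image[OF \<psi>(1), of i] unfolding tuples_def by (blast dest: PiE_mem)+
  with same_cell_close[OF e N k] \<psi> show ?thesis
    using e N by (intro tuple_bottleneck_leI[OF n _ \<psi>(1)]) auto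
qed

text \<open>A matching that keeps all pairs within cells carries one multiset of cells to the other, after the
  \<open>n\<close> copies of \<open>\<Delta>\<close> that pad each tuple are cancelled.\<close>

lemma cells_ne_imp_crossed:
  assumes N: "0 < N" and k: "0 \<le> k" "k < N" and \<phi>: "\<phi> permutes {1..2*n}"
    and ne: "cells e N k n z \<noteq> cells e N k n z'"
  shows "\<exists>i\<in>{1..2*n}. \<exists>r\<in>crossed e (pad n z i) (pad n z' (\<phi> i)). r mod N = k"
proof (rule ccontr)
  assume "\<not> ?thesis"
  then have same: "cell e N k (pad n z i) = cell e N k (pad n z' (\<phi> i))" if "i \<in> {1..2*n}" for i
    using cell_ne_imp_crossed[OF N k] that by blast
  have padded: "image_mset (\<lambda>i. cell e N k (pad n w i)) (mset_set {1..2*n})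
      = cells e N k n w + replicate_mset n None" for w
  proof -
    have "{1..2*n} = {1..n} \<union> {n+1..2*n}" by auto
    then have "mset_set {1..2*n} = mset_set {1..n} + mset_set {n+1..2*n}"
      by (simp add: mset_set_Union)
    moreover have "image_mset (\<lambda>i. cell e N k (pad n w i)) (mset_set {1..n}) = cells e N k n w"
      unfolding cells_def by (rule image_mset_cong) (auto simp: pad_def)
    moreover have "image_mset (\<lambda>i. cell e N k (pad n w i)) (mset_set {n+1..2*n})
        = image_mset (\<lambda>i. None) (mset_set {n+1..2*n})"
      by (rule image_mset_cong) (auto simp: pad_def)
    ultimately show ?thesis by (simp add: image_mset_const_eq)
  qed
  have "image_mset (\<lambda>i. cell e N k (pad n z i)) (mset_set {1..2*n})
      = image_mset (\<lambda>i. cell e N k (pad n z' i)) (image_mset \<phi> (mset_set {1..2*n}))"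
    using same by (auto simp: image_mset.compositionality o_def intro!: image_mset_cong)
  also have "image_mset \<phi> (mset_set {1..2*n}) = mset_set {1..2*n}"
    using image_mset_mset_set[OF permutes_inj_on[OF \<phi>], of "{1..2*n}"] permutes_image[OF \<phi>] by simp
  finally show False using ne padded by simp
qed

section \<open>Random partitions and Hilbert space\<close>

lemma norm_ell2_square_has_sum: "((\<lambda>i. (ell2_coord f i)\<^sup>2) has_sum (norm f)\<^sup>2) UNIV"
proof -
  have "(norm f)\<^sup>2 = (\<Sum>\<^sub>\<infinity>i. (ell2_coord f i)\<^sup>2)"
    unfolding power2_norm_eq_inner by (simp add: inner_ell2.rep_eq power2_eq_square)
  then show ?thesis using has_sum_infsum[OF ell2_coord_summable, of f] by simp
qed

text \<open>The pairs \<open>(y, m)\<close> at which the two indicators differ are \<open>(g m, m)\<close> and \<open>(h m, m)\<close>, for those \<open>m\<close>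
  with \<open>g m \<noteq> h m\<close>; each contributes \<open>c m\<close>, which explains the factor \<open>2\<close>.\<close>

lemma indicator_difference_has_sum:
  fixes g h :: "nat \<Rightarrow> 'a"
  assumes c: "\<And>m. c m \<ge> 0"
    and sum: "(\<lambda>m. c m * of_bool (g m \<noteq> h m)) summable_on UNIV"
  shows "((\<lambda>(y, m). (sqrt (c m) * (of_bool (y = g m) - of_bool (y = h m)))\<^sup>2) has_sum
     2 * (\<Sum>\<^sub>\<infinity>m. c m * of_bool (g m \<noteq> h m))) (UNIV :: ('a \<times> nat) set)"
    (is "(?f has_sum 2 * ?s) UNIV")
proof -
  define M where "M = {m. g m \<noteq> h m}"
  have cM: "(c has_sum ?s) M"
    using has_sum_infsum[OF sum]
    by (rule has_sum_cong_neutral[THEN iffD1, rotated -1]) (auto simp: M_def)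
  have one: "(?f has_sum ?s) ((\<lambda>m. (k m, m)) ` M)" if "k = g \<or> k = h" for k
  proof -
    have "inj_on (\<lambda>m. (k m, m)) M" by (auto intro: inj_onI)
    moreover have "((?f \<circ> (\<lambda>m. (k m, m))) has_sum ?s) M"
      using cM by (rule has_sum_cong[THEN iffD1, rotated]) (use that c in \<open>auto simp: M_def\<close>)
    ultimately show ?thesis by (simp add: has_sum_reindex)
  qed
  have "(?f has_sum (?s + ?s)) ((\<lambda>m. (g m, m)) ` M \<union> (\<lambda>m. (h m, m)) ` M)"
    by (intro has_sum_Un_disjoint one) (auto simp: M_def)
  then have "(?f has_sum (?s + ?s)) UNIV"
    by (rule has_sum_cong_neutral[THEN iffD1, rotated -1])
      (auto simp: M_def of_bool_def split: if_splits)
  then show ?thesis by simp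
qed

text \<open>Each \<open>g m\<close> names the piece of a partition by one of its elements, and \<open>c m\<close> is the weight of the
  partition. A point is sent to the weighted indicators of the pieces that contain it. Since their norms
  need not be summable, the image of a base point is subtracted first; this does not affect distances.\<close>

lemma separation_measure_embeds:
  fixes g :: "nat \<Rightarrow> 'a \<Rightarrow> 'a"
  assumes c: "\<And>m. c m \<ge> 0"
    and sum: "\<And>x y. x \<in> X \<Longrightarrow> y \<in> X \<Longrightarrow> (\<lambda>m. c m * of_bool (g m x \<noteq> g m y)) summable_on UNIV"
  shows "\<exists>F :: 'a \<Rightarrow> ('a \<times> nat) ell2. \<forall>x\<in>X. \<forall>y\<in>X.
     (dist (F x) (F y))\<^sup>2 = 2 * (\<Sum>\<^sub>\<infinity>m. c m * of_bool (g m x \<noteq> g m y))"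
proof (cases "X = {}")
  case False
  then obtain x0 where x0: "x0 \<in> X" by blast
  define v where "v x = (\<lambda>(y, m). sqrt (c m) * (of_bool (y = g m x) - of_bool (y = g m x0)))" for x
  define F where "F x = Abs_ell2 (v x)" for x
  have coord: "ell2_coord (F x) = v x" if x: "x \<in> X" for x
  proof -
    have "(\<lambda>i. (v x i)\<^sup>2) summable_on UNIV"
      using has_sum_imp_summable[OF indicator_difference_has_sum[OF c sum[OF x x0]]]
      by (simp add: v_def case_prod_unfold)
    then show ?thesis unfolding F_def by (intro Abs_ell2_inverse) simp
  qed
  have "(dist (F x) (F y))\<^sup>2 = 2 * (\<Sum>\<^sub>\<infinity>m. c m * of_bool (g m x \<noteq> g m y))"
    if x: "x \<in> X" and y: "y \<in> X" for x y
  proof -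
    have "(\<lambda>i. (ell2_coord (F x - F y) i)\<^sup>2)
        = (\<lambda>(z, m). (sqrt (c m) * (of_bool (z = g m x) - of_bool (z = g m y)))\<^sup>2)"
      by (auto simp: minus_ell2.rep_eq coord[OF x] coord[OF y] v_def fun_eq_iff algebra_simps)
    then show ?thesis
      using has_sum_unique[OF norm_ell2_square_has_sum[of "F x - F y"]]
        indicator_difference_has_sum[OF c sum[OF x y]]
      unfolding dist_norm by simp
  qed
  then show ?thesis by blast
qed simp

lemma sum_inverse_powers_le: "(\<Sum>j<J. 1 / 2 ^ j) \<le> (2::real)"
proof -
  have "(\<Sum>j<J. 1 / 2 ^ j) = (2::real) - 2 / 2 ^ J" for J :: nat
    by (induction J) (auto simp: field_simps)
  then show ?thesis by simp
qed

text \<open>At scale \<open>j\<close>, one of the partitions \<open>P j k\<close> with \<open>k < 2 ^ j\<close> is chosen uniformly at random. The squared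
  distance of two images is twice the sum over \<open>j\<close> of the probabilities of separation. These are at most
  \<open>C * (d x y + 1) / 2 ^ j\<close>, with sum at most \<open>2 * C * (d x y + 1)\<close>; and they are \<open>1\<close> at all scales
  with \<open>K * 2 ^ j < d x y\<close>, so the sum is at least logarithmic in \<open>d x y\<close>.\<close>

lemma random_partitions_imp_coarse_embedding:
  fixes X :: "'a set" and P :: "nat \<Rightarrow> nat \<Rightarrow> 'a \<Rightarrow> 'b"
  assumes nn: "\<And>x y. x \<in> X \<Longrightarrow> y \<in> X \<Longrightarrow> 0 \<le> d x y"
    and C: "C \<ge> 0" and K: "K > 0"
    and bounded: "\<And>j k x y. x \<in> X \<Longrightarrow> y \<in> X \<Longrightarrow> k < 2 ^ j \<Longrightarrow> P j k x = P j k y \<Longrightarrow> d x y \<le> K * 2 ^ j"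
    and rare: "\<And>j x y. x \<in> X \<Longrightarrow> y \<in> X \<Longrightarrow>
       real (card {k. k < 2 ^ j \<and> P j k x \<noteq> P j k y}) \<le> C * (d x y + 1)"
  shows "coarsely_embeds_into_Hilbert X d"
proof -
  \<comment> \<open>The partition \<open>P j k\<close> is indexed by \<open>prod_encode (j, k)\<close>, and a piece by a chosen element of it.\<close>
  define c :: "nat \<Rightarrow> real" where
    "c m = (case prod_decode m of (j, k) \<Rightarrow> if k < 2 ^ j then 1 / 2 ^ j else 0)" for m
  define g where "g m x = (case prod_decode m of (j, k) \<Rightarrow> SOME y. y \<in> X \<and> P j k y = P j k x)" for m x
  let ?w = "\<lambda>x y m. c m * of_bool (g m x \<noteq> g m y)"
  define S where "S j x y = real (card {k. k < 2 ^ j \<and> P j k x \<noteq> P j k y}) / 2 ^ j" for j x y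
  have c_nonneg: "c m \<ge> 0" for m by (simp add: c_def split: prod.split)
  then have w_nonneg: "?w x y m \<ge> 0" for x y m by simp
  have g_eq: "g (prod_encode (j, k)) x = g (prod_encode (j, k)) y \<longleftrightarrow> P j k x = P j k y"
    if "x \<in> X" "y \<in> X" for j k x y
  proof -
    have "P j k (g (prod_encode (j, k)) u) = P j k u" if "u \<in> X" for u
      using someI[of "\<lambda>y. y \<in> X \<and> P j k y = P j k u" u] that by (simp add: g_def)
    moreover have "P j k x = P j k y \<Longrightarrow> g (prod_encode (j, k)) x = g (prod_encode (j, k)) y"
      by (simp add: g_def)
    ultimately show ?thesis using that by metis
  qed
  have block: "(\<Sum>m\<in>prod_encode ` (SIGMA j:{..<J}. {..<2 ^ j}). ?w x y m) = (\<Sum>j<J. S j x y)"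
    if xy: "x \<in> X" "y \<in> X" for J x y
  proof -
    have term_eq: "(?w x y \<circ> prod_encode) u = (case u of (j, k) \<Rightarrow> of_bool (P j k x \<noteq> P j k y) / 2 ^ j)"
      if "u \<in> (SIGMA j:{..<J}. {..<2 ^ j})" for u
    proof -
      obtain j k where u: "u = (j, k)" by (cases u)
      then have "k < 2 ^ j" using that by simp
      then show ?thesis by (cases "P j k x = P j k y") (simp_all add: u g_eq[OF xy, of j k] c_def)
    qed
    have "(\<Sum>m\<in>prod_encode ` (SIGMA j:{..<J}. {..<2 ^ j}). ?w x y m)
        = (\<Sum>(j, k)\<in>(SIGMA j:{..<J}. {..<2 ^ j}). of_bool (P j k x \<noteq> P j k y) / 2 ^ j)"
      by (subst sum.reindex[OF inj_on_subset[OF inj_prod_encode subset_UNIV]])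
        (rule sum.cong[OF refl term_eq])
    also have "\<dots> = (\<Sum>j<J. \<Sum>k<2 ^ j. of_bool (P j k x \<noteq> P j k y) / 2 ^ j)"
      by (subst sum.Sigma) auto
    also have "\<dots> = (\<Sum>j<J. S j x y)"
    proof (rule sum.cong[OF refl])
      fix j
      have "{..<2 ^ j} \<inter> {k. P j k x \<noteq> P j k y} = {k. k < 2 ^ j \<and> P j k x \<noteq> P j k y}" by auto
      then show "(\<Sum>k<2 ^ j. of_bool (P j k x \<noteq> P j k y) / 2 ^ j) = S j x y"
        by (simp add: S_def of_bool_def sum.If_cases flip: sum_divide_distrib)
    qed
    finally show ?thesis .
  qed
  have partial: "sum (?w x y) F \<le> 2 * C * (d x y + 1)" if xy: "x \<in> X" "y \<in> X" and F: "finite F" for x y F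
  proof -
    define J where "J = Suc (Max (insert 0 ((fst \<circ> prod_decode) ` F)))"
    let ?B = "prod_encode ` (SIGMA j:{..<J}. {..<2 ^ j})"
    have "?w x y m = 0" if "m \<in> F - ?B" for m
    proof -
      obtain j k where m: "prod_decode m = (j, k)" by (cases "prod_decode m")
      have "j \<le> Max (insert 0 ((fst \<circ> prod_decode) ` F))"
        using that m F by (intro Max_ge) force+
      then have "j < J" by (simp add: J_def)
      moreover have "m = prod_encode (j, k)" using m by (metis prod_decode_inverse)
      ultimately have "\<not> k < 2 ^ j" using that by auto
      then show ?thesis by (simp add: c_def m)
    qed
    then have "sum (?w x y) F = sum (?w x y) (F \<inter> ?B)"
      by (intro sum.mono_neutral_right F) auto
    also have "\<dots> \<le> sum (?w x y) ?B"
      by (intro sum_mono2 w_nonneg) auto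
    also have "\<dots> = (\<Sum>j<J. S j x y)" by (rule block[OF xy])
    also have "\<dots> \<le> (\<Sum>j<J. C * (d x y + 1) * (1 / 2 ^ j))"
      using rare[OF xy] by (intro sum_mono) (simp add: S_def divide_right_mono)
    also have "\<dots> = C * (d x y + 1) * (\<Sum>j<J. 1 / 2 ^ j)" by (simp add: sum_distrib_left)
    also have "\<dots> \<le> C * (d x y + 1) * 2"
      using C nn[OF xy] by (intro mult_left_mono sum_inverse_powers_le) simp
    finally show ?thesis by simp
  qed
  have summ: "?w x y summable_on UNIV" if xy: "x \<in> X" "y \<in> X" for x y
    using partial[OF xy] w_nonneg
    by (intro nonneg_bdd_above_summable_on) (auto intro!: bdd_aboveI[of _ "2 * C * (d x y + 1)"])
  obtain F :: "'a \<Rightarrow> ('a \<times> nat) ell2" where F: "\<And>x y. x \<in> X \<Longrightarrow> y \<in> X \<Longrightarrow>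
      (dist (F x) (F y))\<^sup>2 = 2 * (\<Sum>\<^sub>\<infinity>m. ?w x y m)"
    using separation_measure_embeds[of c X g, OF c_nonneg summ] by blast
  define \<rho>1 where "\<rho>1 t = sqrt (log 2 (max 1 (t / K)))" for t
  define \<rho>2 where "\<rho>2 t = sqrt (4 * C * (t + 1))" for t
  have upper: "dist (F x) (F y) \<le> \<rho>2 (d x y)" if xy: "x \<in> X" "y \<in> X" for x y
  proof -
    have "(\<Sum>\<^sub>\<infinity>m. ?w x y m) \<le> 2 * C * (d x y + 1)"
      by (rule infsum_le_finite_sums[OF summ[OF xy] partial[OF xy]])
    then show ?thesis unfolding \<rho>2_def using F[OF xy] by (intro real_le_rsqrt) simp
  qed
  have lower: "\<rho>1 (d x y) \<le> dist (F x) (F y)" if xy: "x \<in> X" "y \<in> X" for x y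
  proof (cases "d x y \<le> K")
    case True
    then show ?thesis using K by (simp add: \<rho>1_def max_def)
  next
    case False
    define t where "t = d x y / K"
    have t: "t > 1" using False K by (simp add: t_def)
    \<comment> \<open>The number of scales \<open>j\<close> with \<open>2 ^ j < t\<close>.\<close>
    define J where "J = nat \<lceil>log 2 t\<rceil>"
    have full: "S j x y = 1" if "j < J" for j
    proof -
      have "real j < log 2 t" using that by (simp add: J_def zless_nat_eq_int_zless less_ceiling_iff)
      then have "2 ^ j < t" using t by (simp add: less_log_iff powr_realpow)
      then have "K * 2 ^ j < d x y" using K by (simp add: t_def field_simps)
      then have "{k. k < 2 ^ j \<and> P j k x \<noteq> P j k y} = {..<2 ^ j}"
        using bounded[OF xy, of _ j] by force
      then show ?thesis by (simp add: S_def)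
    qed
    have "log 2 t \<le> real J" unfolding J_def by linarith
    also have "\<dots> = (\<Sum>j<J. S j x y)" using full by simp
    also have "\<dots> = (\<Sum>m\<in>prod_encode ` (SIGMA j:{..<J}. {..<2 ^ j}). ?w x y m)"
      by (rule block[OF xy, symmetric])
    also have "\<dots> \<le> (\<Sum>\<^sub>\<infinity>m. ?w x y m)"
      by (rule finite_sum_le_infsum[OF summ[OF xy]]) (use w_nonneg in auto)
    also have "\<dots> \<le> (dist (F x) (F y))\<^sup>2"
      using F[OF xy] zero_le_power2[of "dist (F x) (F y)"] by linarith
    finally show ?thesis using t unfolding \<rho>1_def t_def[symmetric] by (intro real_le_lsqrt) (auto simp: max_def)
  qed
  have "filterlim (\<lambda>t. t / K) at_top at_top"
    using filterlim_tendsto_pos_mult_at_top[OF tendsto_const[of "1/K"] _ filterlim_ident] K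
    by (simp add: mult.commute)
  then have "filterlim (\<lambda>t. max 1 (t / K)) at_top at_top"
    by (rule filterlim_at_top_mono) simp
  then have "filterlim (\<lambda>t. ln (max 1 (t / K)) * (1 / ln 2)) at_top at_top"
    by (intro filterlim_at_top_mult_tendsto_pos[OF tendsto_const]
        filterlim_compose[OF ln_at_top]) auto
  then have lim: "filterlim \<rho>1 at_top at_top"
    unfolding \<rho>1_def log_def by (intro filterlim_compose[OF sqrt_at_top]) simp
  have mono1: "mono_on {0..} \<rho>1"
  proof (rule mono_onI)
    fix s t :: real assume "s \<le> t"
    then have "s / K \<le> t / K" using K by (simp add: divide_right_mono)
    then have "max 1 (s / K) \<le> max 1 (t / K)" by auto
    then have "log 2 (max 1 (s / K)) \<le> log 2 (max 1 (t / K))" by (intro log_mono) auto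
    then show "\<rho>1 s \<le> \<rho>1 t" by (simp add: \<rho>1_def)
  qed
  have mono2: "mono_on {0..} \<rho>2"
    using C by (auto intro!: mono_onI real_sqrt_le_mono mult_left_mono simp: \<rho>2_def)
  have range: "\<rho>1 \<in> {0..} \<rightarrow> {0..}" "\<rho>2 \<in> {0..} \<rightarrow> {0..}" using C by (auto simp: \<rho>1_def \<rho>2_def)
  have "coarse_embedding X d UNIV dist F"
    unfolding coarse_embedding_def
    by (intro conjI exI[of _ \<rho>1] exI[of _ \<rho>2] range mono1 mono2 lim ballI lower upper) auto
  then show ?thesis unfolding coarsely_embeds_into_Hilbert_def by blast
qed

section \<open>Coloured grids\<close>

definition grid :: "nat \<Rightarrow> nat \<Rightarrow> (nat \<Rightarrow> nat) set" where
  "grid D p = {x. \<forall>i<D. x i \<le> p}"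

definition near :: "nat \<Rightarrow> nat \<Rightarrow> (nat \<Rightarrow> nat) \<Rightarrow> (nat \<Rightarrow> nat) \<Rightarrow> bool" where
  "near D r x y \<longleftrightarrow> (\<forall>i<D. x i \<le> y i + r \<and> y i \<le> x i + r)"

lemma near_trans: "near D r x y \<Longrightarrow> near D s y z \<Longrightarrow> near D (r + s) x z"
  unfolding near_def by fastforce

text \<open>A discrete form of the Lebesgue covering theorem (also a Hex theorem): if a \<open>D\<close>-dimensional grid has
  \<open>D\<close> colours, then some monochromatic piece of some colour \<open>i\<close> reaches from the bottom to the top in
  direction \<open>i\<close>. Otherwise, give \<open>x\<close> the label 0 in direction \<open>i\<close> when it is within distance 1 of a piece of
  colour \<open>i\<close> that reaches the bottom, or lies in the bottom itself, and 1 if not. Kuhn's lemma provides a unit cube on which the labels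
  change in every direction. But they cannot change in the direction given by the colour of the corner
  \<open>q\<close> of this cube: the whole cube is near the piece of \<open>q\<close>, and other pieces of this colour are not
  near the cube.\<close>

lemma coloured_grid_has_crossing:
  fixes col :: "(nat \<Rightarrow> nat) \<Rightarrow> nat" and comp :: "(nat \<Rightarrow> nat) \<Rightarrow> 'u"
  assumes p: "p > 0"
    and col: "\<And>x. x \<in> grid D p \<Longrightarrow> col x < D"
    and sep: "\<And>x y. x \<in> grid D p \<Longrightarrow> y \<in> grid D p \<Longrightarrow> col x = col y \<Longrightarrow> near D 2 x y \<Longrightarrow> comp x = comp y"
  shows "\<exists>x\<in>grid D p. \<exists>y\<in>grid D p. col x = col y \<and> comp x = comp y \<and> x (col x) \<le> 1 \<and> p \<le> y (col x) + 1"
proof (rule ccontr)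
  assume no: "\<not> ?thesis"
  define low where "low x \<longleftrightarrow> (\<exists>u\<in>grid D p. col u = col x \<and> comp u = comp x \<and> u (col x) \<le> 1)" for x
  define label :: "(nat \<Rightarrow> nat) \<Rightarrow> nat \<Rightarrow> nat" where
    "label x i = (if x i = 0 \<or> (\<exists>y\<in>grid D p. near D 1 x y \<and> col y = i \<and> low y) then 0 else 1)" for x i
  have far: "label x i = 1" if x: "x \<in> grid D p" "i < D" "x i = p" for x i
  proof -
    have False if y: "y \<in> grid D p" "near D 1 x y" "col y = i" "low y" for y
    proof -
      obtain u where u: "u \<in> grid D p" "col u = col y" "comp u = comp y" "u (col u) \<le> 1"
        using y(4) unfolding low_def by metis
      have "p \<le> y (col u) + 1" using y(2,3) x u(2) by (auto simp: near_def)
      then show False using no u y(1) by blast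
    qed
    then show ?thesis using x p by (auto simp: label_def)
  qed
  obtain q where q: "\<forall>i<D. q i < p"
    and rs: "\<forall>i<D. \<exists>r s. (\<forall>j<D. q j \<le> r j \<and> r j \<le> q j + 1) \<and>
                 (\<forall>j<D. q j \<le> s j \<and> s j \<le> q j + 1) \<and> label r i \<noteq> label s i"
  proof (rule kuhn_lemma[OF p, of D label])
    show "\<forall>x. (\<forall>i<D. x i \<le> p) \<longrightarrow> (\<forall>i<D. x i = p \<longrightarrow> label x i = 1)"
      using far by (auto simp: grid_def)
  qed (auto simp: label_def)
  have qg: "q \<in> grid D p" using q by (auto simp: grid_def less_imp_le)
  have qD: "col q < D" by (rule col[OF qg])
  obtain r s where r: "\<forall>j<D. q j \<le> r j \<and> r j \<le> q j + 1" and s: "\<forall>j<D. q j \<le> s j \<and> s j \<le> q j + 1"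
    and ne: "label r (col q) \<noteq> label s (col q)"
    using rs qD by blast
  \<comment> \<open>The roles of \<open>r\<close> and \<open>s\<close> are symmetric, so both orders are covered.\<close>
  have contra: False if r: "\<forall>j<D. q j \<le> r j \<and> r j \<le> q j + 1" and s: "\<forall>j<D. q j \<le> s j \<and> s j \<le> q j + 1"
    and r0: "label r (col q) = 0" and s1: "label s (col q) \<noteq> 0" for r s
  proof -
    have "near D 1 s q" using s by (auto simp: near_def)
    then have q_high: "\<not> low q" using s1 qg by (auto simp: label_def split: if_splits)
    have "r (col q) \<noteq> 0"
    proof
      assume "r (col q) = 0"
      then have "q (col q) = 0" using r qD by (metis le_zero_eq)
      then show False using q_high qg by (auto simp: low_def)
    qed
    then obtain y where y: "y \<in> grid D p" "near D 1 r y" "col y = col q" "low y"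
      using r0 by (auto simp: label_def split: if_splits)
    have "near D 1 q r" using r by (auto simp: near_def)
    then have "near D 2 q y" using near_trans[OF _ y(2)] by (simp add: numeral_2_eq_2)
    then have "comp q = comp y" using sep[OF qg y(1)] y(3) by simp
    then show False using y(3,4) q_high by (simp add: low_def)
  qed
  have "label x i = 0 \<or> label x i = 1" for x i by (simp add: label_def)
  then show False using contra[OF r s] contra[OF s r] ne by metis
qed

text \<open>Grid points within distance 2 must fall into the same piece of a 3-disjoint family, while a piece that
  crosses the whole grid is too large once \<open>p > B + 2\<close>.\<close>

lemma asdim_gt_if_large_grids:
  assumes grids: "\<And>B p. \<exists>f. f \<in> grid D p \<rightarrow> X \<and>
      (\<forall>x\<in>grid D p. \<forall>y\<in>grid D p. near D 2 x y \<longrightarrow> d (f x) (f y) < 3) \<and>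
      (\<forall>x\<in>grid D p. \<forall>y\<in>grid D p. d (f x) (f y) \<le> B \<longrightarrow> (\<forall>i<D. \<bar>real (x i) - real (y i)\<bar> \<le> B))"
    and m: "m < D"
  shows "\<not> asdim_le X d m"
proof
  assume "asdim_le X d m"
  then obtain Xs where X: "X = (\<Union>i\<le>m. Xs i)"
    and "\<forall>i\<le>m. \<exists>\<U>. Xs i = \<Union>\<U> \<and> uniformly_bounded d \<U> \<and> R_disjoint d 3 \<U>"
    unfolding asdim_le_def by (meson zero_less_numeral)
  then obtain \<U> where \<U>: "\<And>i. i \<le> m \<Longrightarrow> Xs i = \<Union>(\<U> i) \<and> uniformly_bounded d (\<U> i) \<and> R_disjoint d 3 (\<U> i)"
    by metis
  then obtain b where b: "\<And>i U x y. i \<le> m \<Longrightarrow> U \<in> \<U> i \<Longrightarrow> x \<in> U \<Longrightarrow> y \<in> U \<Longrightarrow> d x y \<le> b i"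
    unfolding uniformly_bounded_def by metis
  define B where "B = Max (insert 0 (b ` {..m}))"
  have B: "b i \<le> B" if "i \<le> m" for i using that unfolding B_def by (intro Max_ge) auto
  define p where "p = nat \<lceil>B\<rceil> + 3"
  have p: "real p > B + 2" unfolding p_def by linarith
  obtain f where f: "f \<in> grid D p \<rightarrow> X"
    and near: "\<forall>x\<in>grid D p. \<forall>y\<in>grid D p. near D 2 x y \<longrightarrow> d (f x) (f y) < 3"
    and far: "\<forall>x\<in>grid D p. \<forall>y\<in>grid D p. d (f x) (f y) \<le> B \<longrightarrow>
        (\<forall>i<D. \<bar>real (x i) - real (y i)\<bar> \<le> B)"
    using grids[of p B] by (elim exE conjE)
  have "\<exists>i U. i \<le> m \<and> U \<in> \<U> i \<and> f x \<in> U" if "x \<in> grid D p" for x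
  proof -
    have "f x \<in> X" using f that by (rule funcset_mem)
    then obtain i where i: "i \<le> m" "f x \<in> Xs i" unfolding X by blast
    then have "f x \<in> \<Union>(\<U> i)" using \<U>[OF i(1)] by simp
    then show ?thesis using i(1) by blast
  qed
  then obtain col comp where cc: "\<And>x. x \<in> grid D p \<Longrightarrow> col x \<le> m \<and> comp x \<in> \<U> (col x) \<and> f x \<in> comp x"
    by metis
  have same: "comp x = comp y" if x: "x \<in> grid D p" and y: "y \<in> grid D p" and c: "col x = col y"
    and n: "near D 2 x y" for x y
  proof (rule ccontr)
    assume "comp x \<noteq> comp y"
    moreover have "R_disjoint d 3 (\<U> (col x))" using \<U> cc[OF x] by blast
    ultimately have "3 \<le> d (f x) (f y)" using cc[OF x] cc[OF y] c unfolding R_disjoint_def by metis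
    moreover have "d (f x) (f y) < 3" using near x y n by blast
    ultimately show False by simp
  qed
  have colD: "col x < D" if "x \<in> grid D p" for x using cc[OF that] m by simp
  have "p > 0" by (simp add: p_def)
  from coloured_grid_has_crossing[of p D col comp, OF this colD same]
  obtain x y where x: "x \<in> grid D p" and y: "y \<in> grid D p" and c: "col x = col y" "comp x = comp y"
    and cross: "x (col x) \<le> 1" "p \<le> y (col x) + 1"
    by blast
  have "d (f x) (f y) \<le> b (col x)" using b[of "col x" "comp x" "f x" "f y"] cc[OF x] cc[OF y] c by simp
  also have "\<dots> \<le> B" using B cc[OF x] by blast
  finally have "\<bar>real (x (col x)) - real (y (col x))\<bar> \<le> B" using far x y colD[OF x] by blast
  moreover have "real (y (col x)) \<ge> real p - 1" using cross by linarith
  ultimately show False using cross p by linarith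
qed

section \<open>Grids of diagrams\<close>

text \<open>The \<open>i\<close>-th point of the diagram moves in a square of side \<open>p\<close> placed at height \<open>C * i\<close>. For large \<open>C\<close>
  the squares are far from each other and from the diagonal, so a matching of small cost has no choice.\<close>

definition grid_tuple :: "nat \<Rightarrow> real \<Rightarrow> (nat \<Rightarrow> nat) \<Rightarrow> nat \<Rightarrow> dgm_point" where
  "grid_tuple n C x =
     (\<lambda>i\<in>{1..n}. Some (real (x (2 * i - 2)), C * real i + real (x (2 * i - 1))))"

lemma grid_tuple_in_tuples:
  assumes "C > real p" "x \<in> grid (2 * n) p"
  shows "grid_tuple n C x \<in> tuples n"
proof -
  have "real (x (2 * i - 2)) < C * real i + real (x (2 * i - 1))" if i: "i \<in> {1..n}" for i
  proof -
    have "2 * i - 2 < 2 * n" using i by auto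
    then have "real (x (2 * i - 2)) \<le> real p" using assms(2) by (auto simp: grid_def)
    also have "\<dots> < C * 1" using assms(1) by simp
    also have "\<dots> \<le> C * real i" using i assms(1) by (intro mult_left_mono) auto
    finally show ?thesis by simp
  qed
  then show ?thesis by (auto simp: tuples_def grid_tuple_def D1_def T_def image_iff)
qed

lemma grid_tuple_near:
  assumes n: "n \<ge> 1" and near: "near (2 * n) r x y"
  shows "tuple_bottleneck n (grid_tuple n C x) (grid_tuple n C y) \<le> real r"
proof (rule tuple_bottleneck_leI[OF n _ permutes_id])
  fix i assume i: "i \<in> {1..n}"
  have le: "\<bar>real (x j) - real (y j)\<bar> \<le> real r" if "j < 2 * n" for j
  proof -
    have "x j \<le> y j + r" "y j \<le> x j + r" using near that by (auto simp: near_def)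
    then show ?thesis by linarith
  qed
  have "2 * i - 2 < 2 * n" "2 * i - 1 < 2 * n" using i by auto
  from this[THEN le] show "delta (grid_tuple n C x i) (grid_tuple n C y (id i)) \<le> real r \<or>
      (delta (grid_tuple n C x i) None \<le> real r \<and> delta None (grid_tuple n C y (id i)) \<le> real r)"
    using i by (simp add: grid_tuple_def dinf_def)
qed simp

lemma grid_tuple_far:
  assumes n: "n \<ge> 1" and B: "B \<ge> 0" and C: "C \<ge> 2 * B + real p + 1"
    and x: "x \<in> grid (2 * n) p" and y: "y \<in> grid (2 * n) p"
    and le: "tuple_bottleneck n (grid_tuple n C x) (grid_tuple n C y) \<le> B" and j: "j < 2 * n"
  shows "\<bar>real (x j) - real (y j)\<bar> \<le> B"
proof -
  obtain \<phi> where \<phi>: "\<phi> permutes {1..2*n}"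
    "\<forall>i\<in>{1..2*n}. delta (pad n (grid_tuple n C x) i) (pad n (grid_tuple n C y) (\<phi> i)) \<le> B"
    using le tuple_bottleneck_le_iff[OF n] by blast
  define i where "i = j div 2 + 1"
  have i: "i \<in> {1..n}" "i \<in> {1..2*n}" and ij: "j = 2 * i - 2 \<or> j = 2 * i - 1"
    using j by (auto simp: i_def)
  have xp: "real (x k) \<le> real p" and yp: "real (y k) \<le> real p" if "k < 2 * n" for k
    using x y that by (auto simp: grid_def)
  have ri: "2 * i - 2 < 2 * n" "2 * i - 1 < 2 * n" using i by auto
  have \<phi>i: "\<phi> i \<in> {1..2*n}" using permutes_in_image[OF \<phi>(1)] i(2) by simp
  have cost: "delta (pad n (grid_tuple n C x) i) (pad n (grid_tuple n C y) (\<phi> i)) \<le> B"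
    using \<phi>(2) i(2) by blast
  have padx: "pad n (grid_tuple n C x) i = Some (real (x (2 * i - 2)), C * real i + real (x (2 * i - 1)))"
    using i by (simp add: pad_def grid_tuple_def)
  have "\<phi> i \<le> n"
  proof (rule ccontr)
    assume "\<not> \<phi> i \<le> n"
    then have "C * real i + real (x (2 * i - 1)) - real (x (2 * i - 2)) \<le> 2 * B"
      using cost padx by (simp add: pad_def)
    moreover have "C * 1 \<le> C * real i" using i B C by (intro mult_left_mono) auto
    ultimately show False using xp[OF ri(1)] C by simp
  qed
  then have l: "\<phi> i \<in> {1..n}" using \<phi>i by simp
  have rl: "2 * \<phi> i - 2 < 2 * n" "2 * \<phi> i - 1 < 2 * n" using l by auto
  have pady: "pad n (grid_tuple n C y) (\<phi> i)
      = Some (real (y (2 * \<phi> i - 2)), C * real (\<phi> i) + real (y (2 * \<phi> i - 1)))"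
    using l by (simp add: pad_def grid_tuple_def)
  have d1: "\<bar>real (x (2 * i - 2)) - real (y (2 * \<phi> i - 2))\<bar> \<le> B"
    and d2: "\<bar>(C * real i + real (x (2 * i - 1))) - (C * real (\<phi> i) + real (y (2 * \<phi> i - 1)))\<bar> \<le> B"
    using cost padx pady by (simp_all add: dinf_def)
  have "\<phi> i = i"
  proof (rule ccontr)
    assume "\<phi> i \<noteq> i"
    then have "1 \<le> \<bar>real i - real (\<phi> i)\<bar>" by linarith
    then have "C * 1 \<le> C * \<bar>real i - real (\<phi> i)\<bar>" using B C by (intro mult_left_mono) auto
    also have "\<dots> = \<bar>C * real i - C * real (\<phi> i)\<bar>"
      using B C by (simp add: abs_mult flip: right_diff_distrib)
    finally show False using d2 xp[OF ri(2)] yp[OF rl(2)] C B by linarith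
  qed
  then show ?thesis using d1 d2 ij by auto
qed

lemma not_asdim_le_bottleneck:
  assumes n: "n \<ge> 1" and m: "m < 2 * n"
  shows "\<not> asdim_le (diagrams n) (bottleneck_dist n) m"
proof (rule asdim_gt_if_large_grids[OF _ m])
  fix B :: real and p :: nat
  define C where "C = 2 * max B 0 + real p + 1"
  have Cp: "C > real p" by (simp add: C_def)
  define f where "f x = perm_rel n `` {grid_tuple n C x}" for x
  have in_t: "grid_tuple n C x \<in> tuples n" if "x \<in> grid (2 * n) p" for x
    by (rule grid_tuple_in_tuples[OF Cp that])
  have f: "f x \<in> diagrams n" if "x \<in> grid (2 * n) p" for x
    unfolding f_def diagrams_def using in_t[OF that] by (rule quotientI)
  have dist: "bottleneck_dist n (f x) (f y) = tuple_bottleneck n (grid_tuple n C x) (grid_tuple n C y)"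
    if "x \<in> grid (2 * n) p" "y \<in> grid (2 * n) p" for x y
  proof (rule bottleneck_dist_eq[OF f f])
    show "grid_tuple n C x \<in> f x" "grid_tuple n C y \<in> f y"
      unfolding f_def by (rule equiv_class_self[OF equiv_perm_rel in_t]; fact)+
  qed fact+
  have close: "bottleneck_dist n (f x) (f y) < 3"
    if "x \<in> grid (2 * n) p" "y \<in> grid (2 * n) p" "near (2 * n) 2 x y" for x y
    using grid_tuple_near[OF n that(3), of C] dist[OF that(1,2)] by simp
  have far: "\<bar>real (x i) - real (y i)\<bar> \<le> B"
    if "x \<in> grid (2 * n) p" "y \<in> grid (2 * n) p" "bottleneck_dist n (f x) (f y) \<le> B" "i < 2 * n" for x y i
  proof -
    have "0 \<le> bottleneck_dist n (f x) (f y)" using bottleneck_dist_nonneg[OF n f f] that by blast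
    then have "B \<ge> 0" using that(3) by simp
    then show ?thesis using grid_tuple_far[OF n _ _ that(1,2) _ that(4), of B C] dist[OF that(1,2)] that(3)
      by (simp add: C_def)
  qed
  show "\<exists>f. f \<in> grid (2 * n) p \<rightarrow> diagrams n \<and>
      (\<forall>x\<in>grid (2 * n) p. \<forall>y\<in>grid (2 * n) p. near (2 * n) 2 x y \<longrightarrow> bottleneck_dist n (f x) (f y) < 3) \<and>
      (\<forall>x\<in>grid (2 * n) p. \<forall>y\<in>grid (2 * n) p. bottleneck_dist n (f x) (f y) \<le> B \<longrightarrow>
         (\<forall>i<2 * n. \<bar>real (x i) - real (y i)\<bar> \<le> B))"
    using f close far by (intro exI[of _ f]) auto
qed

section \<open>Colourings and random partitions of diagram space\<close>

text \<open>Summed over the \<open>2 * n\<close> pairs of an optimal matching, the number of blocks crossed bounds the number of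
  colours \<open>k\<close> that separate the two tuples.\<close>

lemma rarely_separated:
  assumes n: "n \<ge> 1" and e: "e > 0" and N: "0 < N" and z: "z \<in> tuples n" "z' \<in> tuples n"
  shows "real (card {k. k < nat N \<and> cells e N (int k) n z \<noteq> cells e N (int k) n z'})
    \<le> 2 * n * (3 * (tuple_bottleneck n z z' / e) + 2)"
proof -
  let ?b = "tuple_bottleneck n z z'"
  obtain \<phi> where \<phi>: "\<phi> permutes {1..2*n}"
    and le: "\<forall>i\<in>{1..2*n}. delta (pad n z i) (pad n z' (\<phi> i)) \<le> ?b"
    using optimal_matching[OF n] .
  define C where "C i = crossed e (pad n z i) (pad n z' (\<phi> i))" for i
  have C: "finite (C i)" "real (card (C i)) \<le> 3 * (?b / e) + 2" if i: "i \<in> {1..2*n}" for i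
  proof -
    note pts = pad_in_D1[OF z(1) i] permuted_pad_in_D1[OF z(2) \<phi> i]
    show "finite (C i)" unfolding C_def by (rule card_crossed(1)[OF e pts])
    have "real (card (C i)) \<le> 3 * (delta (pad n z i) (pad n z' (\<phi> i)) / e) + 2"
      unfolding C_def by (rule card_crossed(2)[OF e pts])
    also have "\<dots> \<le> 3 * (?b / e) + 2" using bspec[OF le i] e by (simp add: divide_right_mono)
    finally show "real (card (C i)) \<le> 3 * (?b / e) + 2" .
  qed
  have "{k. k < nat N \<and> cells e N (int k) n z \<noteq> cells e N (int k) n z'}
      \<subseteq> (\<lambda>r. nat (r mod N)) ` (\<Union>i\<in>{1..2*n}. C i)"
  proof
    fix k assume k: "k \<in> {k. k < nat N \<and> cells e N (int k) n z \<noteq> cells e N (int k) n z'}"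
    then have "int k < N" by auto
    then obtain i r where "i \<in> {1..2*n}" "r \<in> C i" "r mod N = int k"
      using cells_ne_imp_crossed[OF N _ _ \<phi>, of "int k" e z z'] k unfolding C_def by auto
    then show "k \<in> (\<lambda>r. nat (r mod N)) ` (\<Union>i\<in>{1..2*n}. C i)"
      by (intro image_eqI[of _ _ r]) auto
  qed
  then have "card {k. k < nat N \<and> cells e N (int k) n z \<noteq> cells e N (int k) n z'}
      \<le> card ((\<lambda>r. nat (r mod N)) ` (\<Union>i\<in>{1..2*n}. C i))"
    using C(1) by (intro card_mono finite_imageI finite_UN_I) auto
  also have "\<dots> \<le> card (\<Union>i\<in>{1..2*n}. C i)"
    using C(1) by (intro card_image_le finite_UN_I) auto
  also have "\<dots> \<le> (\<Sum>i\<in>{1..2*n}. card (C i))" by (rule card_UN_le) simp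
  finally have "real (card {k. k < nat N \<and> cells e N (int k) n z \<noteq> cells e N (int k) n z'})
      \<le> real (\<Sum>i\<in>{1..2*n}. card (C i))" by (rule of_nat_mono)
  also have "\<dots> = (\<Sum>i\<in>{1..2*n}. real (card (C i)))" by simp
  also have "\<dots> \<le> (\<Sum>i\<in>{1..2*n}. 3 * (?b / e) + 2)" by (rule sum_mono) (rule C(2))
  also have "\<dots> = 2 * n * (3 * (?b / e) + 2)" by simp
  finally show ?thesis by simp
qed

text \<open>The \<open>n\<close> points have at most \<open>2 * n\<close> block numbers, and there are \<open>2 * n + 1\<close> residues.\<close>

lemma free_colour_exists:
  fixes z :: "nat \<Rightarrow> dgm_point"
  shows "\<exists>k\<le>2*n. \<forall>i\<in>{1..n}. \<forall>r\<in>levels e (z i). r mod (2 * int n + 1) \<noteq> int k"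
proof (rule ccontr)
  let ?N = "2 * int n + 1"
  let ?L = "\<Union>i\<in>{1..n}. levels e (z i)"
  assume "\<not> ?thesis"
  then have "{..2*n} \<subseteq> (\<lambda>r. nat (r mod ?N)) ` ?L" by (force simp: image_iff)
  moreover have fin: "finite (levels e x)" and two: "card (levels e x) \<le> 2" for x
    by (cases "(e, x)" rule: levels.cases; simp add: card_insert_if)+
  moreover have L: "finite ?L" using fin by simp
  ultimately have "card {..2*n} \<le> card ((\<lambda>r. nat (r mod ?N)) ` ?L)"
    by (intro card_mono finite_imageI)
  also have "\<dots> \<le> card ?L" using L by (rule card_image_le)
  also have "\<dots> \<le> (\<Sum>i\<in>{1..n}. card (levels e (z i)))" by (rule card_UN_le) simp
  also have "\<dots> \<le> (\<Sum>i\<in>{1..n}. 2)" by (rule sum_mono) (rule two)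
  finally show False by simp
qed

text \<open>The set of colour \<open>k\<close> consists of the diagrams without a coordinate in the first block of a cell of that
  colour; its pieces are the classes of diagrams with the same cells. A matching of cost below \<open>R = e / 2\<close>
  crosses no block start except those of the blocks of its end points; between two diagrams of this set
  these are not starts of cells.\<close>

lemma asdim_le_bottleneck:
  assumes n: "n \<ge> 1"
  shows "asdim_le (diagrams n) (bottleneck_dist n) (2 * n)"
  unfolding asdim_le_def
proof (intro allI impI)
  fix R :: real assume R: "R > 0"
  define e where "e = 2 * R"
  define N where "N = 2 * int n + 1"
  define rep where "rep Z = (SOME z. z \<in> Z)" for Z :: "(nat \<Rightarrow> dgm_point) set"
  define free where "free k z \<longleftrightarrow> (\<forall>i\<in>{1..n}. \<forall>r\<in>levels e (z i). r mod N \<noteq> int k)" for k z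
  define Xs where "Xs k = {Z \<in> diagrams n. free k (rep Z)}" for k
  define \<U> where "\<U> k = {{Z \<in> Xs k. cells e N (int k) n (rep Z) = c} | c. True}" for k
  have e: "e > 0" and N: "0 < N" using R by (auto simp: e_def N_def)
  have dist: "bottleneck_dist n Z Z' = tuple_bottleneck n (rep Z) (rep Z')" for Z Z'
    by (simp add: bottleneck_dist_def rep_def)
  have rep: "rep Z \<in> tuples n" if "Z \<in> diagrams n" for Z
    using representative_in_tuples[OF that] by (simp add: rep_def)
  have "\<exists>k\<le>2*n. free k (rep Z)" for Z
    using free_colour_exists[of n e "rep Z"] by (simp add: free_def N_def)
  then have cover: "diagrams n = (\<Union>k\<le>2*n. Xs k)"
    unfolding Xs_def by blast
  have pieces: "Xs k = \<Union>(\<U> k)" for k by (auto simp: \<U>_def)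
  have bounded: "uniformly_bounded (bottleneck_dist n) (\<U> k)" if "k \<le> 2 * n" for k
  proof -
    have k: "0 \<le> int k" "int k < N" using that by (auto simp: N_def)
    have "bottleneck_dist n Z Z' \<le> 2 * e * N" if "U \<in> \<U> k" "Z \<in> U" "Z' \<in> U" for U Z Z'
      unfolding dist using that by (intro same_cells_close[OF n e N k]) (auto simp: \<U>_def Xs_def rep)
    then show ?thesis unfolding uniformly_bounded_def by blast
  qed
  have disjoint: "R_disjoint (bottleneck_dist n) R (\<U> k)" if "k \<le> 2 * n" for k
  proof -
    have k: "0 \<le> int k" "int k < N" using that by (auto simp: N_def)
    have "R \<le> bottleneck_dist n Z Z'"
      if U: "U \<in> \<U> k" "V \<in> \<U> k" "U \<noteq> V" and Z: "Z \<in> U" "Z' \<in> V" for U V Z Z'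
    proof (rule ccontr)
      assume "\<not> ?thesis"
      then have close: "tuple_bottleneck n (rep Z) (rep Z') < e / 2" by (simp add: dist e_def)
      have ZX: "Z \<in> Xs k" "Z' \<in> Xs k"
        and ne: "cells e N (int k) n (rep Z) \<noteq> cells e N (int k) n (rep Z')"
        using U Z by (auto simp: \<U>_def)
      have z: "rep Z \<in> tuples n" "rep Z' \<in> tuples n" and fr: "free k (rep Z)" "free k (rep Z')"
        using ZX by (auto simp: Xs_def rep)
      obtain \<phi> where \<phi>: "\<phi> permutes {1..2*n}"
        and le: "\<forall>i\<in>{1..2*n}. delta (pad n (rep Z) i) (pad n (rep Z') (\<phi> i))
                   \<le> tuple_bottleneck n (rep Z) (rep Z')"
        using optimal_matching[OF n] .
      obtain i r where i: "i \<in> {1..2*n}" and r: "r \<in> crossed e (pad n (rep Z) i) (pad n (rep Z') (\<phi> i))"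
        and rk: "r mod N = int k"
        using cells_ne_imp_crossed[OF N k \<phi> ne] by blast
      have \<phi>i: "\<phi> i \<in> {1..2*n}" using permutes_in_image[OF \<phi>] i by simp
      have "crossed e (pad n (rep Z) i) (pad n (rep Z') (\<phi> i))
          \<subseteq> levels e (pad n (rep Z) i) \<union> levels e (pad n (rep Z') (\<phi> i))"
        using bspec[OF le i] close
        by (intro crossed_subset_levels[OF e pad_in_D1[OF z(1) i] pad_in_D1[OF z(2) \<phi>i]]) simp
      then have "r \<in> levels e (pad n (rep Z) i) \<or> r \<in> levels e (pad n (rep Z') (\<phi> i))"
        using r by blast
      then show False
        using fr rk i \<phi>i unfolding free_def pad_def by (auto split: if_splits)
    qed
    then show ?thesis unfolding R_disjoint_def by blast
  qed
  show "\<exists>Xs. diagrams n = (\<Union>k\<le>2*n. Xs k) \<and> (\<forall>k\<le>2*n. \<exists>\<U>. Xs k = \<Union>\<U> \<and>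
      uniformly_bounded (bottleneck_dist n) \<U> \<and> R_disjoint (bottleneck_dist n) R \<U>)"
  proof (intro exI[of _ Xs] conjI allI impI)
    fix k assume k: "k \<le> 2 * n"
    show "\<exists>\<U>. Xs k = \<Union>\<U> \<and>
        uniformly_bounded (bottleneck_dist n) \<U> \<and> R_disjoint (bottleneck_dist n) R \<U>"
      using pieces[of k] bounded[OF k] disjoint[OF k] by (intro exI[of _ "\<U> k"]) simp
  qed (rule cover)
qed

text \<open>Blocks of length \<open>1\<close>, joined to cells of \<open>2 ^ j\<close> blocks, with the start of the cells chosen at random.\<close>

lemma bottleneck_embeds_into_Hilbert:
  assumes n: "n \<ge> 1"
  shows "coarsely_embeds_into_Hilbert (diagrams n) (bottleneck_dist n)"
proof -
  define rep where "rep Z = (SOME z. z \<in> Z)" for Z :: "(nat \<Rightarrow> dgm_point) set"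
  have rep: "rep Z \<in> tuples n" if "Z \<in> diagrams n" for Z
    using representative_in_tuples[OF that] by (simp add: rep_def)
  have dist: "bottleneck_dist n Z Z' = tuple_bottleneck n (rep Z) (rep Z')" for Z Z'
    by (simp add: bottleneck_dist_def rep_def)
  show ?thesis
  proof (rule random_partitions_imp_coarse_embedding[where C = "6 * n" and K = 2
        and P = "\<lambda>j k Z. cells 1 (2 ^ j) (int k) n (rep Z)"])
    fix j k :: nat and Z Z'
    assume Z: "Z \<in> diagrams n" "Z' \<in> diagrams n" and k: "k < 2 ^ j"
      and eq: "cells 1 (2 ^ j) (int k) n (rep Z) = cells 1 (2 ^ j) (int k) n (rep Z')"
    have "int k < 2 ^ j" using k by (metis of_nat_less_iff of_nat_numeral of_nat_power)
    from same_cells_close[OF n _ _ _ this rep[OF Z(1)] rep[OF Z(2)] eq]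
    show "bottleneck_dist n Z Z' \<le> 2 * 2 ^ j" by (simp add: dist)
  next
    fix j :: nat and Z Z' assume Z: "Z \<in> diagrams n" "Z' \<in> diagrams n"
    have nat_pow: "nat (2 ^ j) = 2 ^ j" by (simp add: nat_power_eq)
    have "real (card {k. k < 2 ^ j \<and> cells 1 (2 ^ j) (int k) n (rep Z) \<noteq> cells 1 (2 ^ j) (int k) n (rep Z')})
        \<le> 2 * n * (3 * bottleneck_dist n Z Z' + 2)"
      using rarely_separated[OF n _ _ rep[OF Z(1)] rep[OF Z(2)], of 1 "2 ^ j"]
      unfolding nat_pow dist by simp
    also have "\<dots> \<le> real (6 * n) * (bottleneck_dist n Z Z' + 1)" by (simp add: algebra_simps)
    finally show "real (card {k. k < 2 ^ j \<and> cells 1 (2 ^ j) (int k) n (rep Z) \<noteq> cells 1 (2 ^ j) (int k) n (rep Z')})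
        \<le> real (6 * n) * (bottleneck_dist n Z Z' + 1)" .
  qed (auto simp: bottleneck_dist_nonneg[OF n])
qed

lemma asdim_eqI:
  assumes "asdim_le X d m" "\<And>k. k < m \<Longrightarrow> \<not> asdim_le X d k"
  shows "asdim X d = enat m"
  unfolding asdim_def
proof (rule antisym)
  show "Inf {enat m |m. asdim_le X d m} \<le> enat m" using assms(1) by (intro Inf_lower) blast
  show "enat m \<le> Inf {enat m |m. asdim_le X d m}"
    using assms(2) by (intro Inf_greatest) (auto simp: not_less[symmetric])
qed

theorem theorem3p2:
  fixes n :: nat and p :: real
  assumes "n \<ge> 1" and "p > 1"
  shows "asdim (diagrams n) (wasserstein_dist n p) = enat (2 * n) \<and>
         asdim (diagrams n) (bottleneck_dist n) = enat (2 * n) \<and>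
         coarsely_embeds_into_Hilbert (diagrams n) (wasserstein_dist n p) \<and>
         coarsely_embeds_into_Hilbert (diagrams n) (bottleneck_dist n)"
proof (intro conjI)
  note n = \<open>n \<ge> 1\<close>
  have K: "real (2 * n) > 0" using n by simp
  have lower: "bottleneck_dist n Z Z' \<le> wasserstein_dist n p Z Z'"
    if "Z \<in> diagrams n" "Z' \<in> diagrams n" for Z Z'
    unfolding bottleneck_dist_def wasserstein_dist_def
    using that assms by (intro tuple_bottleneck_le_wasserstein representative_in_tuples) auto
  have upper: "wasserstein_dist n p Z Z' \<le> real (2 * n) * bottleneck_dist n Z Z'"
    if "Z \<in> diagrams n" "Z' \<in> diagrams n" for Z Z'
    unfolding bottleneck_dist_def wasserstein_dist_def
    using tuple_wasserstein_le_bottleneck[OF n _ that[THEN representative_in_tuples], of p] assms by simp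
  have same: "asdim_le (diagrams n) (bottleneck_dist n) m
      \<longleftrightarrow> asdim_le (diagrams n) (wasserstein_dist n p) m" for m
    by (rule asdim_le_lipschitz_equiv[OF K]) (fact lower upper)+
  have transfer: "coarse_embedding (diagrams n) (wasserstein_dist n p) UNIV dist f"
    if "coarse_embedding (diagrams n) (bottleneck_dist n) UNIV dist f"
    for f :: "(nat \<Rightarrow> dgm_point) set \<Rightarrow> ((nat \<Rightarrow> dgm_point) set \<times> nat) ell2"
    by (rule coarse_embedding_lipschitz_equiv[OF K _ _ _ that])
      (fact bottleneck_dist_nonneg[OF n] lower upper)+
  show "asdim (diagrams n) (bottleneck_dist n) = enat (2 * n)"
    by (rule asdim_eqI[OF asdim_le_bottleneck[OF n] not_asdim_le_bottleneck[OF n]])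
  then show "asdim (diagrams n) (wasserstein_dist n p) = enat (2 * n)"
    unfolding asdim_def using same by simp
  show "coarsely_embeds_into_Hilbert (diagrams n) (bottleneck_dist n)"
    by (rule bottleneck_embeds_into_Hilbert[OF n])
  then show "coarsely_embeds_into_Hilbert (diagrams n) (wasserstein_dist n p)"
    unfolding coarsely_embeds_into_Hilbert_def using transfer by blast
qed

end
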